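(* Let $A,E\in\mathbb{R}^{n\times n}$ and $K(z)=(zE-A)^{-1}$. Assume the matrix pencil $(A,E)$ is regular, and let $\alpha,\beta\in\mathbb{C}$ be such that $W:=\alpha E+\beta A$ is invertible. Let $\theta_1,\theta_2\in(-\pi,\pi)$ and assume that $e^{\mathrm{j}\phi}$ is not an eigenvalue of $(A,E)$ for any $\phi\in\mathbb{R}$ with $\mathrm{wrap}(\phi)\in[\theta_1,\theta_2]$. For $\epsilon\in\mathbb{C}$ put $A_\epsilon:=A+\alpha\epsilon I$, $E_\epsilon:=E-\beta\epsilon I$, $\Gamma(\theta,\epsilon):=(E_\epsilon+A_\epsilon)\tan(\theta/2)-\mathrm{j}(E_\epsilon-A_\epsilon)$, and $\eta:=\log\Big(\frac{\tan(\theta_2/2)-\mathrm{j}}{\tan(\theta_1/2)-\mathrm{j}}\Big)$. Then $$\int_{\theta_1}^{\theta_2}K(e^{\mathrm{j}\theta})\,d\theta=\lim_{\epsilon\to0}\frac{1}{\mathrm{j}}A_\epsilon^{-1}\Big(-\eta I+\log\big(\Gamma(\theta_2,\epsilon)\Gamma(\theta_1,\epsilon)^{-1}\big)\Big)=\lim_{\epsilon\to0}\frac{1}{\mathrm{j}}\Big(-\eta I+\log\big(\Gamma(\theta_1,\epsilon)^{-1}\Gamma(\theta_2,\epsilon)\big)\Big)A_\epsilon^{-1}.$$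
   Context: $\mathrm{j}=\sqrt{-1}$. A pencil $(A,E)$ is regular if $\alpha E+\beta A$ is invertible for at least one pair of complex numbers $\alpha,\beta$; $\lambda\in\mathbb{C}$ is an eigenvalue of $(A,E)$ if $\det(A-\lambda E)=0$. $\mathrm{wrap}(\phi)$ denotes the principal argument of $e^{\mathrm{j}\phi}$, lying in $(-\pi,\pi]$. $\log$ denotes the principal (scalar or matrix) logarithm, i.e. the logarithm whose eigenvalues have imaginary parts in $(-\pi,\pi)$, defined when there are no eigenvalues on the closed negative real axis. *)

theory Defs
  imports "HOL-Analysis.Analysis"
begin

definition cmat :: "real^'n^'m \<Rightarrow> complex^'n^'m" where
  "cmat M = (\<chi> i j. complex_of_real (M $ i $ j))"

fun mpow :: "complex^'n^'n \<Rightarrow> nat \<Rightarrow> complex^'n^'n" where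
  "mpow M 0 = mat 1"
| "mpow M (Suc k) = M ** mpow M k"

definition mat_exp :: "complex^'n^'n \<Rightarrow> complex^'n^'n" where
  "mat_exp M = (\<Sum>k. mat (1 / of_nat (fact k)) ** mpow M k)"

definition mat_eigenvalue :: "complex^'n^'n \<Rightarrow> complex \<Rightarrow> bool" where
  "mat_eigenvalue M l \<longleftrightarrow> det (M - mat l) = 0"

definition mat_log_defined :: "complex^'n^'n \<Rightarrow> bool" where
  "mat_log_defined M \<longleftrightarrow> (\<forall>l. mat_eigenvalue M l \<longrightarrow> \<not> (Im l = 0 \<and> Re l \<le> 0))"

definition mat_log :: "complex^'n^'n \<Rightarrow> complex^'n^'n" where
  "mat_log M = (THE L. mat_exp L = M \<and> (\<forall>l. mat_eigenvalue L l \<longrightarrow> -pi < Im l \<and> Im l < pi))"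

definition pencil_eigenvalue :: "complex^'n^'n \<Rightarrow> complex^'n^'n \<Rightarrow> complex \<Rightarrow> bool" where
  "pencil_eigenvalue A E l \<longleftrightarrow> det (A - mat l ** E) = 0"

definition regular_pencil :: "complex^'n^'n \<Rightarrow> complex^'n^'n \<Rightarrow> bool" where
  "regular_pencil A E \<longleftrightarrow> (\<exists>a b. invertible (mat a ** E + mat b ** A))"

definition wrap :: "real \<Rightarrow> real" where
  "wrap \<phi> = Arg (exp (\<i> * complex_of_real \<phi>))"

end

theory Submission
  imports Defs "HOL-Computational_Algebra.Fundamental_Theorem_Algebra"
begin

text \<open>The matrix $\Gamma$ is affine in $t = \tan(\theta/2)$ with slope $E + A$, and it is a nonzero scalar
  multiple of $e^{i\theta} E - A$, hence invertible on the whole arc. Thus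
  $\Gamma(\theta)\Gamma(\theta_1)^{-1} = I + sZ$ for $s = t - t_1$ is a segment of invertible
  matrices starting at $I$, and $\log(I + hZ) = \int_0^h Z (I + sZ)^{-1} ds$ is the principal
  logarithm. Subtracting the scalar case, which is $\eta$, and substituting $s = \tan(\theta/2) - t_1$
  turns the integrand into $i A (e^{i\theta} E - A)^{-1}$. This is applied to the perturbed pencils, whose
  resolvents converge uniformly on the arc as $\epsilon \to 0$.\<close>

section \<open>Complex matrices\<close>

text \<open>The inverse of A_epsilon is the reason for the perturbation: after the substitution the
  integrand carries the factor i A besides the resolvent, and A itself may be singular. For every
  small epsilon with A_epsilon invertible both closed forms equal the perturbed integral exactly, so
  the limits express only the continuity of that integral at 0. The delicate point is that
  \<open>mat_log\<close> is a definite description over all matrices: the integral has to be the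
  only X with exp X = I + hZ and spectrum in the open strip. A competing X commutes with its own
  exponential, hence with hZ and with the integral, and commuting matrices with equal exponentials
  and spectra in the strip coincide. Spectral questions are settled by eigenvectors inside invariant
  subspaces instead of a normal form: commutation provides one vector on which both matrices act as
  scalars, and there the scalar statement decides.\<close>

lemma mat_vector_mult: "mat c *v x = c *s (x :: 'a::semiring_1^'n)"
  by (vector matrix_vector_mult_def mat_def) (simp add: if_distrib if_distribR cong: if_cong)

lemma mat_matrix_mult_nth: "(mat c ** X) $ i $ j = c * (X $ i $ j :: 'a::semiring_1)"
  by (simp add: matrix_matrix_mult_def mat_def if_distrib if_distribR cong: if_cong)

lemma matrix_mult_mat_nth: "(X ** mat c) $ i $ j = (X $ i $ j :: 'a::semiring_1) * c"
  by (simp add: matrix_matrix_mult_def mat_def if_distrib if_distribR cong: if_cong)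

lemma mat_mult_commute: "mat c ** X = X ** mat (c :: 'a::comm_semiring_1)"
  by (simp add: vec_eq_iff mat_matrix_mult_nth matrix_mult_mat_nth mult.commute)

lemma mat_mult_mat: "mat c ** mat d = (mat (c * d) :: 'a::semiring_1^'n^'n)"
  by (simp add: vec_eq_iff mat_matrix_mult_nth) (simp add: mat_def)

lemma mat_of_real_mult: "mat (of_real r) ** X = r *\<^sub>R (X :: complex^'n^'m)"
  by (simp add: vec_eq_iff mat_matrix_mult_nth) (simp add: scaleR_conv_of_real)

lemma bounded_bilinear_matrix_mult:
  "bounded_bilinear ((**) :: complex^'n^'m \<Rightarrow> complex^'p^'n \<Rightarrow> complex^'p^'m)"
proof -
  have "bilinear ((**) :: complex^'n^'m \<Rightarrow> complex^'p^'n \<Rightarrow> complex^'p^'m)"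
    unfolding bilinear_def
    by (auto intro!: linearI simp: vec_eq_iff matrix_matrix_mult_def algebra_simps sum.distrib scaleR_sum_right)
  then show ?thesis
    by (simp add: bilinear_conv_bounded_bilinear)
qed

interpretation matrix_mult: bounded_bilinear "(**) :: complex^'n^'m \<Rightarrow> complex^'p^'n \<Rightarrow> complex^'p^'m"
  by (rule bounded_bilinear_matrix_mult)

lemma bounded_bilinear_matrix_vector_mult:
  "bounded_bilinear ((*v) :: complex^'n^'m \<Rightarrow> complex^'n \<Rightarrow> complex^'m)"
proof -
  have "bilinear ((*v) :: complex^'n^'m \<Rightarrow> complex^'n \<Rightarrow> complex^'m)"
    unfolding bilinear_def
    by (auto intro!: linearI simp: vec_eq_iff matrix_vector_mult_def algebra_simps sum.distrib scaleR_sum_right)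
  then show ?thesis
    by (simp add: bilinear_conv_bounded_bilinear)
qed

interpretation matrix_vector_mult: bounded_bilinear "(*v) :: complex^'n^'m \<Rightarrow> complex^'n \<Rightarrow> complex^'m"
  by (rule bounded_bilinear_matrix_vector_mult)

lemma bounded_linear_mat: "bounded_linear (mat :: complex \<Rightarrow> complex^'n^'n)"
  unfolding linear_conv_bounded_linear [symmetric]
  by (rule linearI) (simp_all add: vec_eq_iff mat_def)

lemma scale_eq_cart: "c *s (X *v v) = X *v (c *s (v :: complex^'n))"
  by (vector matrix_vector_mult_def sum_distrib_left ac_simps)

lemma matrix_inv_mult:
  assumes "invertible (A :: 'a::semiring_1^'n^'n)"
  shows "A ** matrix_inv A = mat 1" "matrix_inv A ** A = mat 1"
proof -
  have "A ** matrix_inv A = mat 1 \<and> matrix_inv A ** A = mat 1"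
    using assms unfolding matrix_inv_def invertible_def by (rule someI_ex)
  then show "A ** matrix_inv A = mat 1" "matrix_inv A ** A = mat 1" by auto
qed

lemma matrix_inv_eqI:
  fixes A B :: "'a::semiring_1^'n^'n"
  assumes "A ** B = mat 1" "B ** A = mat 1"
  shows "matrix_inv A = B"
proof -
  have "invertible A" using assms by (auto simp: invertible_def)
  then have "matrix_inv A ** A = mat 1" by (rule matrix_inv_mult(2))
  then have "matrix_inv A = matrix_inv A ** (A ** B)" by (simp add: assms)
  also have "\<dots> = B" using \<open>matrix_inv A ** A = mat 1\<close> by (simp add: matrix_mul_assoc)
  finally show ?thesis .
qed

lemma invertible_iff_kernel:
  "invertible (A :: 'a::field^'n^'n) \<longleftrightarrow> (\<forall>x. A *v x = 0 \<longrightarrow> x = 0)"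
  by (simp add: invertible_left_inverse matrix_left_invertible_ker)

lemma mat_eigenvalue_iff: "mat_eigenvalue M l \<longleftrightarrow> (\<exists>v. v \<noteq> 0 \<and> M *v v = l *s v)"
proof -
  have "mat_eigenvalue M l \<longleftrightarrow> \<not> invertible (M - mat l)"
    by (simp add: mat_eigenvalue_def invertible_det_nz)
  also have "\<dots> \<longleftrightarrow> (\<exists>v. v \<noteq> 0 \<and> M *v v = l *s v)"
    by (auto simp: invertible_iff_kernel matrix_vector_mult_diff_rdistrib mat_vector_mult)
  finally show ?thesis .
qed

lemma continuous_on_det:
  fixes f :: "'a::topological_space \<Rightarrow> complex^'n^'n"
  assumes "continuous_on S f"
  shows "continuous_on S (\<lambda>x. det (f x))"
  unfolding det_def by (intro continuous_intros assms)

text \<open>Cramer's rule writes every entry of the inverse as a quotient of determinants, which are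
  polynomials in the entries.\<close>

lemma continuous_on_matrix_inv:
  fixes f :: "'a::topological_space \<Rightarrow> complex^'n^'n"
  assumes f: "continuous_on S f" and inv: "\<And>x. x \<in> S \<Longrightarrow> invertible (f x)"
  shows "continuous_on S (\<lambda>x. matrix_inv (f x))"
proof -
  have entry: "matrix_inv (f x) $ k $ l =
      det (\<chi> i j. if j = k then axis l 1 $ i else f x $ i $ j) / det (f x)" if "x \<in> S" for x k l
  proof -
    have "f x *v (matrix_inv (f x) *v axis l 1) = axis l 1"
      by (simp add: matrix_vector_mul_assoc matrix_inv_mult inv that)
    then have "matrix_inv (f x) *v axis l 1 =
        (\<chi> k. det (\<chi> i j. if j = k then axis l 1 $ i else f x $ i $ j) / det (f x))"
      using inv[OF that] by (simp add: cramer invertible_det_nz)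
    moreover have "(matrix_inv (f x) *v axis l 1) $ k = matrix_inv (f x) $ k $ l"
      by (simp add: matrix_vector_mult_def axis_def if_distrib cong: if_cong)
    ultimately show ?thesis by simp
  qed
  have "continuous_on S (\<lambda>x. \<chi> k l. det (\<chi> i j. if j = k then axis l 1 $ i else f x $ i $ j) / det (f x))"
  proof (intro continuous_on_vec_lambda continuous_on_divide continuous_on_det f)
    show "continuous_on S (\<lambda>x. if j = k then axis l 1 $ i else f x $ i $ j)" for i j k and l :: 'n
      by (cases "j = k") (auto intro!: continuous_intros f)
  qed (use inv in \<open>simp add: invertible_det_nz\<close>)
  then show ?thesis
    by (rule continuous_on_eq) (simp add: vec_eq_iff entry)
qed

section \<open>Common eigenvectors\<close>

text \<open>This is p(M)v computed by Horner's scheme. Only the action on one vector is ever needed,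
  so the matrix p(M) is not formed.\<close>

definition poly_apply :: "complex^'n^'n \<Rightarrow> complex^'n \<Rightarrow> complex poly \<Rightarrow> complex^'n" where
  "poly_apply M v p = fold_coeffs (\<lambda>a w. a *s v + M *v w) p 0"

lemma poly_apply_0 [simp]: "poly_apply M v 0 = 0"
  by (simp add: poly_apply_def)

lemma poly_apply_pCons [simp]: "poly_apply M v (pCons a p) = a *s v + M *v poly_apply M v p"
  by (cases "p = 0 \<and> a = 0") (auto simp: poly_apply_def)

lemma poly_apply_add: "poly_apply M v (p + q) = poly_apply M v p + poly_apply M v q"
  by (induction p q rule: poly_induct2)
     (simp_all add: matrix_vector_right_distrib vec.scale_left_distrib)

lemma poly_apply_smult: "poly_apply M v (smult c p) = c *s poly_apply M v p"
  by (induction p) (simp_all add: scale_eq_cart vec.scale_right_distrib)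

lemma poly_apply_sum: "poly_apply M v (\<Sum>i\<in>I. p i) = (\<Sum>i\<in>I. poly_apply M v (p i))"
  by (induction I rule: infinite_finite_induct) (simp_all add: poly_apply_add)

lemma poly_apply_monom: "poly_apply M v (monom c i) = c *s (((*v) M ^^ i) v)"
  by (induction i) (simp_all add: monom_0 monom_Suc scale_eq_cart)

lemma poly_apply_linear_factor:
  "poly_apply M v ([:- z, 1:] * q) = M *v poly_apply M v q - z *s poly_apply M v q"
  using poly_apply_smult[of M v "- z" q] poly_apply_add[of M v "pCons 0 q" "smult (- z) q"]
  by (simp add: algebra_simps)

lemma poly_apply_in_subspace:
  assumes "vec.subspace S" "\<And>w. w \<in> S \<Longrightarrow> M *v w \<in> S" "v \<in> S"
  shows "poly_apply M v p \<in> S"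
  by (induction p) (auto intro: vec.subspace_add vec.subspace_scale vec.subspace_0 assms)

text \<open>The iterates v, Mv, M^2 v, ... cannot stay independent beyond the dimension; the
  coefficients of a linear relation among them form p.\<close>

lemma exists_annihilating_poly:
  fixes M :: "complex^'n^'n"
  obtains p where "p \<noteq> 0" "poly_apply M v p = 0"
proof -
  define x where "x i = ((*v) M ^^ i) v" for i
  show thesis
  \<comment> \<open>Linear dependence is a property of sets, so a repetition among the iterates has
    to be treated apart; it gives the relation M^i v - M^j v = 0 directly.\<close>
  proof (cases "inj x")
    case False
    then obtain i j where "x i = x j" "i \<noteq> j" by (auto simp: inj_def)
    then have "poly_apply M v (monom 1 i + monom (- 1) j) = 0"
      by (simp add: poly_apply_add poly_apply_monom x_def)
    moreover have "coeff (monom 1 i + monom (- 1) j) i \<noteq> (0 :: complex)"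
      using \<open>i \<noteq> j\<close> by simp
    then have "monom 1 i + monom (- 1) j \<noteq> (0 :: complex poly)"
      by force
    ultimately show thesis using that by blast
  next
    case True
    define B where "B = x ` {..vec.dimension TYPE(complex) TYPE('n)}"
    have "card B = Suc (vec.dimension TYPE(complex) TYPE('n))"
      unfolding B_def using True by (subst card_image) (auto intro: inj_on_subset)
    then have "vec.dependent B"
      using vec.dim_subset_UNIV[of B] by (intro vec.dependent_biggerset_general) auto
    then obtain t u where t: "finite t" "t \<subseteq> B" "(\<Sum>w\<in>t. u w *s w) = 0" and "\<exists>w\<in>t. u w \<noteq> 0"
      unfolding vec.dependent_explicit by blast
    then obtain w where w: "w \<in> t" "u w \<noteq> 0" by blast
    \<comment> \<open>The relation is indexed by vectors; injectivity of \<open>x\<close> turns it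
      into one indexed by exponents.\<close>
    define I where "I = {i. x i \<in> t}"
    have tI: "t = x ` I" using t by (auto simp: I_def B_def)
    have "inj_on x I" using True by (auto intro: inj_on_subset)
    then have fin: "finite I" using t tI by (metis finite_image_iff)
    define p where "p = (\<Sum>i\<in>I. monom (u (x i)) i)"
    have "poly_apply M v p = (\<Sum>i\<in>I. u (x i) *s x i)"
      by (simp add: p_def poly_apply_sum poly_apply_monom x_def)
    also have "\<dots> = (\<Sum>w\<in>t. u w *s w)"
      using tI \<open>inj_on x I\<close> by (simp add: sum.reindex)
    finally have "poly_apply M v p = 0" using t by simp
    moreover obtain i where i: "i \<in> I" "w = x i" using w tI by auto
    have "coeff p i = u (x i)"
      using fin i by (simp add: p_def coeff_sum)
    then have "p \<noteq> 0" using w i by force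
    ultimately show thesis using that by blast
  qed
qed

text \<open>Split a root z off a polynomial that annihilates u, leaving q. Either q(M)u is nonzero,
  and then it is an eigenvector for z lying in the invariant subspace, or q annihilates u and has
  smaller degree. A nonzero constant cannot annihilate u, so the descent ends.\<close>

lemma exists_eigenvector_in_subspace:
  fixes M :: "complex^'n^'n"
  assumes S: "vec.subspace S" and inv: "\<And>w. w \<in> S \<Longrightarrow> M *v w \<in> S"
    and "u \<in> S" "u \<noteq> 0"
  obtains v m where "v \<in> S" "v \<noteq> 0" "M *v v = m *s v"
proof -
  obtain p0 where "p0 \<noteq> 0" "poly_apply M u p0 = 0"
    using exists_annihilating_poly by blast
  then have "\<exists>v m. v \<in> S \<and> v \<noteq> 0 \<and> M *v v = m *s v"
  proof (induction "degree p0" arbitrary: p0 rule: less_induct)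
    case less
    show ?case
    proof (cases "degree p0 = 0")
      case True
      then obtain c where "p0 = [:c:]" by (rule degree_eq_zeroE)
      with less \<open>u \<noteq> 0\<close> show ?thesis by (auto simp: vec.scale_eq_0_iff)
    next
      case False
      then have "\<not> constant (poly p0)" by (simp add: constant_degree)
      then obtain z where "poly p0 z = 0" using fundamental_theorem_of_algebra by blast
      then obtain q where q: "p0 = [:- z, 1:] * q" by (auto simp: poly_eq_0_iff_dvd)
      with less have "q \<noteq> 0" by auto
      show ?thesis
      proof (cases "poly_apply M u q = 0")
        case True
        have "degree p0 = Suc (degree q)"
          using \<open>q \<noteq> 0\<close> unfolding q by (subst degree_mult_eq) auto
        then show ?thesis using less(1)[of q] \<open>q \<noteq> 0\<close> True by simp
      next
        case False
        moreover have "M *v poly_apply M u q = z *s poly_apply M u q"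
          using less(3) unfolding q poly_apply_linear_factor by simp
        ultimately show ?thesis
          using poly_apply_in_subspace[OF S inv \<open>u \<in> S\<close>] by blast
      qed
    qed
  qed
  then show thesis using that by blast
qed

lemma subspace_eigenspace: "vec.subspace {v. M *v v = l *s (v :: complex^'n)}"
  by (auto simp: vec.subspace_def matrix_vector_right_distrib vec.scale_right_distrib
      simp flip: scale_eq_cart)

text \<open>Since Y commutes with X, it preserves the eigenspaces of X; an eigenvector of Y is
  sought inside one of them, intersected with S.\<close>

lemma common_eigenvector:
  fixes X Y :: "complex^'n^'n"
  assumes S: "vec.subspace S" and "u \<in> S" "u \<noteq> 0" and comm: "X ** Y = Y ** X"
    and X: "\<And>w. w \<in> S \<Longrightarrow> X *v w \<in> S" and Y: "\<And>w. w \<in> S \<Longrightarrow> Y *v w \<in> S"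
  obtains v x y where "v \<in> S" "v \<noteq> 0" "X *v v = x *s v" "Y *v v = y *s v"
proof -
  obtain w x where w: "w \<in> S" "w \<noteq> 0" "X *v w = x *s w"
    using exists_eigenvector_in_subspace[OF S X] assms by metis
  let ?T = "S \<inter> {v. X *v v = x *s v}"
  have "vec.subspace ?T"
    by (intro vec.subspace_inter S subspace_eigenspace)
  moreover have "Y *v v \<in> ?T" if "v \<in> ?T" for v
  proof -
    have "X *v (Y *v v) = Y *v (X *v v)"
      by (simp add: matrix_vector_mul_assoc comm)
    then show ?thesis using that Y by (simp add: scale_eq_cart)
  qed
  ultimately obtain v y where "v \<in> ?T" "v \<noteq> 0" "Y *v v = y *s v"
    using exists_eigenvector_in_subspace[of ?T Y w] w by blast
  then show thesis using that by blast
qed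

section \<open>The matrix exponential\<close>

lemma norm_exp_minus_first_two:
  fixes x :: "'a::{real_normed_algebra_1,banach}"
  assumes "norm x \<le> 1"
  shows "norm (exp x - 1 - x) \<le> (norm x)\<^sup>2"
proof -
  let ?f = "\<lambda>n. inverse (fact (n + 2)) *\<^sub>R x ^ (n + 2)"
  let ?g = "\<lambda>n. inverse (fact (n + 2)) *\<^sub>R norm x ^ (n + 2)"
  have g: "summable ?g"
    using summable_exp_generic[of "norm x"] by (rule summable_ignore_initial_segment)
  have "norm (suminf ?f) \<le> suminf ?g"
    by (rule norm_suminf_le[OF _ g]) (auto intro!: mult_left_mono norm_power_ineq simp del: power_Suc)
  also have "\<dots> = exp (norm x) - 1 - norm x"
    using exp_first_two_terms[of "norm x"] by simp
  also have "\<dots> \<le> (norm x)\<^sup>2"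
    using exp_bound[of "norm x"] assms by simp
  finally show ?thesis
    using exp_first_two_terms[of x] by simp
qed

lemma has_derivative_exp_at_0:
  "(exp has_derivative (\<lambda>h. h)) (at (0 :: 'a::{real_normed_algebra_1,banach}))"
proof -
  have "((\<lambda>h::'a. norm (exp h - 1 - h) / norm h) \<longlongrightarrow> 0) (at 0)"
  proof (rule tendsto_0_le[where K = 1])
    show "(norm \<longlongrightarrow> 0) (at (0::'a))" by (rule tendsto_norm_zero) simp
    have "\<forall>\<^sub>F h in at (0::'a). norm h < 1"
      by (rule order_tendstoD[OF tendsto_norm_zero]) auto
    then show "\<forall>\<^sub>F h in at (0::'a). norm (norm (exp h - 1 - h) / norm h) \<le> norm (norm h) * 1"
    proof eventually_elim
      case (elim h)
      then show ?case
        using norm_exp_minus_first_two[of h] by (simp add: divide_le_eq power2_eq_square)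
    qed
  qed
  then show ?thesis
    by (simp add: has_derivative_at)
qed

text \<open>Commutation with the single value f t gives exp (f s) = exp (f t) exp (f s - f t), so
  only the derivative of exp at 0 enters.\<close>

lemma has_vector_derivative_exp_commuting:
  fixes f :: "real \<Rightarrow> 'a::{real_normed_algebra_1,banach}"
  assumes f: "(f has_vector_derivative f') (at t within S)" and t: "t \<in> S"
    and comm: "\<And>s. s \<in> S \<Longrightarrow> f s * f t = f t * f s"
  shows "((\<lambda>s. exp (f s)) has_vector_derivative exp (f t) * f') (at t within S)"
proof -
  have "((\<lambda>s. f s - f t) has_derivative (\<lambda>h. h *\<^sub>R f')) (at t within S)"
    using f unfolding has_vector_derivative_def by (auto intro!: derivative_eq_intros)
  then have "((\<lambda>s. exp (f s - f t)) has_derivative (\<lambda>h. h *\<^sub>R f')) (at t within S)"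
    by (rule has_derivative_compose[where g = exp]) (simp add: has_derivative_exp_at_0)
  then have "((\<lambda>s. exp (f t) * exp (f s - f t)) has_derivative (\<lambda>h. exp (f t) * (h *\<^sub>R f'))) (at t within S)"
    by (rule has_derivative_mult_right)
  then have "((\<lambda>s. exp (f t) * exp (f s - f t)) has_vector_derivative exp (f t) * f') (at t within S)"
    by (simp add: has_vector_derivative_def)
  then show ?thesis
  proof (rule has_vector_derivative_transform[OF t, rotated])
    fix s assume "s \<in> S"
    then have "f t * (f s - f t) = (f s - f t) * f t"
      using comm by (simp add: algebra_simps)
    from exp_add_commuting[OF this] show "exp (f s) = exp (f t) * exp (f s - f t)"
      by simp
  qed
qed

text \<open>The power series of the entire function (e^x - 1)/x, which makes sense for arguments
  that are not invertible.\<close>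

definition exp_quotient :: "'a::{real_normed_algebra_1,banach} \<Rightarrow> 'a" where
  "exp_quotient x = (\<Sum>n. x ^ n /\<^sub>R fact (Suc n))"

lemma summable_exp_quotient:
  fixes x :: "'a::{real_normed_algebra_1,banach}"
  shows "summable (\<lambda>n. x ^ n /\<^sub>R fact (Suc n))"
proof (rule summable_comparison_test[OF _ summable_norm_exp[of x]], intro exI allI impI)
  fix n :: nat
  have "(fact n :: real) \<le> fact (Suc n)" by (rule fact_mono) simp
  then have "inverse (fact (Suc n)) \<le> (inverse (fact n) :: real)"
    by (rule le_imp_inverse_le) simp
  then show "norm (x ^ n /\<^sub>R fact (Suc n)) \<le> norm (x ^ n /\<^sub>R fact n)"
    by (simp del: fact_Suc add: mult_right_mono)
qed

lemma exp_eq_exp_quotient: "exp x = 1 + x * exp_quotient x"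
  using suminf_mult[OF summable_exp_quotient, of x x]
  by (simp add: exp_first_term[of x] exp_quotient_def del: fact_Suc)

lemma exp_quotient_commutes: "x * y = y * x \<Longrightarrow> exp_quotient x * y = y * exp_quotient x"
  by (simp add: exp_quotient_def suminf_mult[OF summable_exp_quotient, symmetric]
      suminf_mult2[OF summable_exp_quotient] power_commuting_commutes del: fact_Suc)

text \<open>Products in \<^typ>\<open>complex^'n^'n\<close> are taken entrywise by the library instances. This copy of the type
  carries matrix multiplication and the operator norm, so that \<^const>\<open>exp\<close> of Banach algebras is
  the matrix exponential.\<close>

typedef (overloaded) 'n sqmat = "UNIV :: (complex^'n^'n) set"
  morphisms of_sqmat to_sqmat ..

setup_lifting type_definition_sqmat

instantiation sqmat :: (finite) real_algebra_1
begin
lift_definition zero_sqmat :: "'a sqmat" is 0 .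
lift_definition one_sqmat :: "'a sqmat" is "mat 1" .
lift_definition plus_sqmat :: "'a sqmat \<Rightarrow> 'a sqmat \<Rightarrow> 'a sqmat" is "(+)" .
lift_definition minus_sqmat :: "'a sqmat \<Rightarrow> 'a sqmat \<Rightarrow> 'a sqmat" is "(-)" .
lift_definition uminus_sqmat :: "'a sqmat \<Rightarrow> 'a sqmat" is uminus .
lift_definition times_sqmat :: "'a sqmat \<Rightarrow> 'a sqmat \<Rightarrow> 'a sqmat" is "(**)" .
lift_definition scaleR_sqmat :: "real \<Rightarrow> 'a sqmat \<Rightarrow> 'a sqmat" is scaleR .
instance
proof
  show "(0 :: 'a sqmat) \<noteq> 1"
    by transfer (simp add: vec_eq_iff mat_def)
qed (transfer; simp add: matrix_mul_assoc matrix_mult.add_left matrix_mult.add_right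
      matrix_mult.scaleR_left matrix_mult.scaleR_right scaleR_add_right scaleR_add_left)+
end

instantiation sqmat :: (finite) real_normed_algebra_1
begin
lift_definition norm_sqmat :: "'a sqmat \<Rightarrow> real" is "\<lambda>M. onorm ((*v) M)" .
definition dist_sqmat :: "'a sqmat \<Rightarrow> 'a sqmat \<Rightarrow> real" where "dist_sqmat x y = norm (x - y)"
definition sgn_sqmat :: "'a sqmat \<Rightarrow> 'a sqmat" where "sgn_sqmat x = x /\<^sub>R norm x"
definition uniformity_sqmat :: "('a sqmat \<times> 'a sqmat) filter" where
  "uniformity_sqmat = (INF e\<in>{0<..}. principal {(x, y). dist x y < e})"
definition open_sqmat :: "'a sqmat set \<Rightarrow> bool" where
  "open_sqmat U \<longleftrightarrow> (\<forall>x\<in>U. \<forall>\<^sub>F (x', y) in uniformity. x' = x \<longrightarrow> y \<in> U)"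
instance
proof
  fix x y :: "'a sqmat" and a :: real
  show "norm x = 0 \<longleftrightarrow> x = 0"
    by transfer (simp add: onorm_eq_0 matrix_vector_mult.bounded_linear_right matrix_eq)
  show "norm (x + y) \<le> norm x + norm y"
  proof transfer
    fix x y :: "complex^'a^'a"
    have "(*v) (x + y) = (\<lambda>v. x *v v + y *v v)"
      by (simp add: fun_eq_iff matrix_vector_mult.add_left)
    then show "onorm ((*v) (x + y)) \<le> onorm ((*v) x) + onorm ((*v) y)"
      by (simp add: onorm_triangle matrix_vector_mult.bounded_linear_right)
  qed
  show "norm (a *\<^sub>R x) = \<bar>a\<bar> * norm x"
  proof transfer
    fix a :: real and x :: "complex^'a^'a"
    have "(*v) (a *\<^sub>R x) = (\<lambda>v. a *\<^sub>R (x *v v))"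
      by (simp add: fun_eq_iff matrix_vector_mult.scaleR_left)
    then show "onorm ((*v) (a *\<^sub>R x)) = \<bar>a\<bar> * onorm ((*v) x)"
      by (simp add: onorm_scaleR matrix_vector_mult.bounded_linear_right)
  qed
  show "norm (x * y) \<le> norm x * norm y"
  proof transfer
    fix x y :: "complex^'a^'a"
    have "(*v) (x ** y) = (*v) x \<circ> (*v) y"
      by (simp add: fun_eq_iff matrix_vector_mul_assoc)
    then show "onorm ((*v) (x ** y)) \<le> onorm ((*v) x) * onorm ((*v) y)"
      by (simp add: onorm_compose matrix_vector_mult.bounded_linear_right)
  qed
  show "norm (1 :: 'a sqmat) = 1"
  proof transfer
    have "(*v) (mat 1) = (\<lambda>v :: complex^'a. v)"
      by (simp add: fun_eq_iff)
    then show "onorm ((*v) (mat 1 :: complex^'a^'a)) = 1"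
      by (simp add: onorm_id)
  qed
qed (simp_all add: dist_sqmat_def sgn_sqmat_def uniformity_sqmat_def open_sqmat_def)
end

text \<open>With its converse \<open>bounded_linear_of_sqmat\<close> this expresses that the two
  norms are equivalent, so limits, series and derivatives can be moved between the two
  types.\<close>

lemma bounded_linear_to_sqmat: "bounded_linear (to_sqmat :: complex^'n^'n \<Rightarrow> 'n sqmat)"
proof -
  obtain K where K: "\<And>(M::complex^'n^'n) v. norm (M *v v) \<le> norm M * norm v * K"
    using matrix_vector_mult.bounded by blast
  show ?thesis
  proof (rule bounded_linear_intro[where K = K])
    show "norm (to_sqmat M) \<le> norm M * K" for M :: "complex^'n^'n"
      using K[of M] by (simp add: norm_sqmat.abs_eq) (rule onorm_le, simp add: ac_simps)
  qed (simp_all add: plus_sqmat.abs_eq scaleR_sqmat.abs_eq)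
qed

lemma norm_of_sqmat_nth: "norm (of_sqmat X $ i $ j) \<le> norm X"
proof -
  have "norm (of_sqmat X $ i $ j) = norm ((of_sqmat X *v axis j 1) $ i)"
    by (simp add: matrix_vector_mult_def axis_def if_distrib cong: if_cong)
  also have "\<dots> \<le> norm (of_sqmat X *v axis j 1)"
    by (rule Finite_Cartesian_Product.norm_nth_le)
  also have "\<dots> \<le> norm X"
    using onorm[OF matrix_vector_mult.bounded_linear_right, of "of_sqmat X" "axis j 1"]
    by (simp add: norm_sqmat.rep_eq)
  finally show ?thesis .
qed

lemma bounded_linear_of_sqmat_nth: "bounded_linear (\<lambda>X. of_sqmat X $ i $ j)"
  by (rule bounded_linear_intro[where K = 1])
     (simp_all add: plus_sqmat.rep_eq scaleR_sqmat.rep_eq norm_of_sqmat_nth)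

instance sqmat :: (finite) banach
proof
  fix X :: "nat \<Rightarrow> 'a sqmat"
  assume "Cauchy X"
  then have "convergent (\<lambda>n. of_sqmat (X n) $ i $ j)" for i j
    by (intro Cauchy_convergent bounded_linear.Cauchy[OF bounded_linear_of_sqmat_nth])
  then have "\<exists>m. \<forall>i j. (\<lambda>n. of_sqmat (X n) $ i $ j) \<longlonglongrightarrow> m i j"
    unfolding convergent_def by metis
  then obtain m where "\<And>i j. (\<lambda>n. of_sqmat (X n) $ i $ j) \<longlonglongrightarrow> m i j" by blast
  then have "(\<lambda>n. of_sqmat (X n)) \<longlonglongrightarrow> (\<chi> i j. m i j)"
    by (intro vec_tendstoI) simp
  from bounded_linear.tendsto[OF bounded_linear_to_sqmat this]
  have "X \<longlonglongrightarrow> to_sqmat (\<chi> i j. m i j)"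
    by (simp add: of_sqmat_inverse)
  then show "convergent X"
    by (auto simp: convergent_def)
qed

lemma bounded_linear_of_sqmat: "bounded_linear (of_sqmat :: 'n::finite sqmat \<Rightarrow> complex^'n^'n)"
proof (rule bounded_linear_intro)
  fix X :: "'n sqmat"
  have "norm (of_sqmat X) \<le> (\<Sum>i\<in>UNIV. norm (of_sqmat X $ i))"
    unfolding norm_vec_def by (rule L2_set_le_sum) simp
  also have "\<dots> \<le> (\<Sum>i\<in>(UNIV::'n set). \<Sum>j\<in>(UNIV::'n set). norm X)"
    unfolding norm_vec_def[of "of_sqmat X $ _"]
    by (intro sum_mono order.trans[OF L2_set_le_sum]) (auto simp: norm_of_sqmat_nth)
  finally show "norm (of_sqmat X) \<le> norm X * (real CARD('n) * real CARD('n))"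
    by (simp add: ac_simps)
qed (simp_all add: plus_sqmat.rep_eq scaleR_sqmat.rep_eq)

section \<open>Eigenvectors and injectivity of the matrix exponential\<close>

lemma mpow_of_sqmat: "mpow (of_sqmat X) k = of_sqmat (X ^ k)"
  by (induction k) (simp_all add: one_sqmat.rep_eq times_sqmat.rep_eq)

lemma mat_exp_of_sqmat: "mat_exp (of_sqmat X) = of_sqmat (exp X)"
proof -
  have "mat (1 / of_nat (fact k)) ** mpow (of_sqmat X) k = of_sqmat (X ^ k /\<^sub>R fact k)" for k
    using mat_of_real_mult[of "inverse (fact k)" "of_sqmat (X ^ k)"]
    by (simp add: mpow_of_sqmat scaleR_sqmat.rep_eq inverse_eq_divide)
  then show ?thesis
    using bounded_linear.suminf[OF bounded_linear_of_sqmat summable_exp_generic[of X]]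
    by (simp add: mat_exp_def exp_def)
qed

lemma bounded_linear_sqmat_apply: "bounded_linear (\<lambda>X. of_sqmat X *v v)"
  by (rule bounded_linear_compose[OF matrix_vector_mult.bounded_linear_left bounded_linear_of_sqmat])

lemma sqmat_power_eigenvector:
  "of_sqmat X *v v = x *s v \<Longrightarrow> of_sqmat (X ^ n) *v v = x ^ n *s v"
  by (induction n)
     (simp_all add: one_sqmat.rep_eq times_sqmat.rep_eq mult.commute
       flip: matrix_vector_mul_assoc scale_eq_cart)

lemma scaleR_eq_scale: "r *\<^sub>R v = of_real r *s (v :: complex^'n)"
  by (simp add: vec_eq_iff scaleR_conv_of_real[where 'a=complex])

lemma bounded_linear_scale: "bounded_linear (\<lambda>c. c *s (v :: complex^'n))"
  unfolding linear_conv_bounded_linear [symmetric]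
  by (rule linearI) (simp_all add: vec_eq_iff algebra_simps)

lemma exp_eigenvector:
  assumes "of_sqmat X *v v = x *s v"
  shows "of_sqmat (exp X) *v v = exp x *s v"
proof -
  have "(\<lambda>n. of_sqmat (X ^ n /\<^sub>R fact n) *v v) sums (of_sqmat (exp X) *v v)"
    using bounded_linear.sums[OF bounded_linear_sqmat_apply exp_converges[of X]] .
  moreover have "of_sqmat (X ^ n /\<^sub>R fact n) *v v = (x ^ n /\<^sub>R fact n) *s v" for n
    by (simp add: scaleR_sqmat.rep_eq matrix_vector_mult.scaleR_left sqmat_power_eigenvector[OF assms])
       (simp add: scaleR_eq_scale scaleR_conv_of_real[where 'a=complex])
  moreover from bounded_linear.sums[OF bounded_linear_scale exp_converges[of x]]
  have "(\<lambda>n. (x ^ n /\<^sub>R fact n) *s v) sums (exp x *s v)" .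
  ultimately show ?thesis
    by (simp add: sums_unique2)
qed

text \<open>On the kernel of X only the constant term of the series survives, and it equals
  1.\<close>

lemma exp_quotient_kernel:
  assumes "of_sqmat X *v v = 0"
  shows "of_sqmat (exp_quotient X) *v v = v"
proof -
  have "(\<lambda>n. of_sqmat (X ^ n /\<^sub>R fact (Suc n)) *v v) sums (of_sqmat (exp_quotient X) *v v)"
    unfolding exp_quotient_def
    by (rule bounded_linear.sums[OF bounded_linear_sqmat_apply summable_sums[OF summable_exp_quotient]])
  moreover have "of_sqmat (X ^ n /\<^sub>R fact (Suc n)) *v v = (if n = 0 then v else 0)" for n
    using sqmat_power_eigenvector[of X v 0 n] assms
    by (simp add: scaleR_sqmat.rep_eq matrix_vector_mult.scaleR_left power_0_left)
  moreover have "(\<lambda>n::nat. if n = 0 then v else 0) sums v"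
    by (rule sums_single)
  ultimately show ?thesis
    by (simp add: sums_unique2)
qed

text \<open>With $N = X - Y$ the assumption reads $N \varphi(N) = 0$ for $\varphi(x) = (e^x - 1)/x$. If
  $\varphi(N)$ had a kernel, it would contain a common eigenvector of $X$ and $Y$; the strip condition
  makes the two eigenvalues equal, so $N$ vanishes and $\varphi(N)$ is the identity on that vector.\<close>

lemma exp_inj_commuting:
  fixes X Y :: "'n::finite sqmat"
  assumes comm: "X * Y = Y * X" and eq: "exp X = exp Y"
    and X: "\<And>l. mat_eigenvalue (of_sqmat X) l \<Longrightarrow> - pi < Im l \<and> Im l < pi"
    and Y: "\<And>l. mat_eigenvalue (of_sqmat Y) l \<Longrightarrow> - pi < Im l \<and> Im l < pi"
  shows "X = Y"
proof -
  define N where "N = X - Y"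
  define B where "B = exp_quotient N"
  have NX: "N * X = X * N" and NY: "N * Y = Y * N"
    using comm by (simp_all add: N_def algebra_simps)
  have "exp X = exp (N + Y)" by (simp add: N_def)
  also have "\<dots> = exp N * exp Y" by (rule exp_add_commuting[OF NY])
  finally have "exp N * (exp Y * exp (- Y)) = exp Y * exp (- Y)"
    using eq by (simp flip: mult.assoc)
  then have "exp N = 1" by (simp add: exp_minus_inverse)
  then have NB: "N * B = 0"
    using exp_eq_exp_quotient[of N] by (simp add: B_def)
  have BN: "B * N = 0"
    using NB exp_quotient_commutes[of N N] by (simp add: B_def)
  have inv: "w = 0" if "of_sqmat B *v w = 0" for w
  proof (rule ccontr)
    assume "w \<noteq> 0"
    \<comment> \<open>The kernel is written as the eigenspace for 0, the form in which
      \<open>subspace_eigenspace\<close> provides the subspace property.\<close>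
    let ?S = "{w. of_sqmat B *v w = 0 *s w}"
    have closed: "of_sqmat Z *v u \<in> ?S" if "N * Z = Z * N" "u \<in> ?S" for Z u
    proof -
      have "B * Z = Z * B" using exp_quotient_commutes[OF that(1)] by (simp add: B_def)
      then have "of_sqmat B ** of_sqmat Z = of_sqmat Z ** of_sqmat B"
        by (simp flip: times_sqmat.rep_eq)
      then show ?thesis
        using that(2) by (simp add: matrix_vector_mul_assoc) (simp flip: matrix_vector_mul_assoc)
    qed
    have "of_sqmat X ** of_sqmat Y = of_sqmat Y ** of_sqmat X"
      using comm by (simp flip: times_sqmat.rep_eq)
    from common_eigenvector[OF subspace_eigenspace _ \<open>w \<noteq> 0\<close> this closed[OF NX] closed[OF NY]]
    obtain v x y where v: "v \<in> ?S" "v \<noteq> 0" "of_sqmat X *v v = x *s v" "of_sqmat Y *v v = y *s v"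
      using \<open>of_sqmat B *v w = 0\<close> by auto
    have "exp x *s v = exp y *s v"
      using exp_eigenvector[OF v(3)] exp_eigenvector[OF v(4)] eq by metis
    then have "exp x = exp y" using \<open>v \<noteq> 0\<close> by simp
    moreover have "\<bar>Im x\<bar> < pi" "\<bar>Im y\<bar> < pi"
      using X[of x] Y[of y] v by (fastforce simp: mat_eigenvalue_iff abs_less_iff)+
    ultimately have "x = y"
      by (metis Ln_exp abs_less_iff less_imp_le minus_less_iff)
    then have "of_sqmat N *v v = 0"
      using v by (simp add: N_def minus_sqmat.rep_eq matrix_vector_mult_diff_rdistrib)
    then have "of_sqmat B *v v = v" unfolding B_def by (rule exp_quotient_kernel)
    with v show False by simp
  qed
  have "of_sqmat B *v (of_sqmat N *v u) = 0" for u
    using BN by (simp add: matrix_vector_mul_assoc zero_sqmat.rep_eq flip: times_sqmat.rep_eq)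
  then have "of_sqmat N *v u = 0" for u by (rule inv)
  then have "of_sqmat N = 0" by (simp add: matrix_eq)
  then have "N = 0" by (simp flip: of_sqmat_inject add: zero_sqmat.rep_eq)
  then show ?thesis by (simp add: N_def)
qed

section \<open>The principal logarithm as an integral\<close>

text \<open>The line from 1 to r <= 0 meets the origin at the fraction 1/(1 - r) of the way. Hence a
  segment that starts at 1 and avoids 0 avoids the whole closed negative axis.\<close>

lemma segment_to_origin_nonpos:
  assumes "1 + of_real s * z = of_real r" "r \<le> 0"
  shows "1 + of_real (s / (1 - r)) * z = (0 :: complex)"
proof -
  have "of_real (1 - r) \<noteq> (0 :: complex)"
    using assms(2) by (simp only: of_real_eq_0_iff)
  moreover have "of_real s * z = of_real r - 1"
    using assms(1) by (simp add: algebra_simps)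
  ultimately show ?thesis
    by (simp add: divide_simps)
qed

lemma divide_one_minus_mem:
  fixes s r h :: real
  assumes "s \<in> {0..h}" "r \<le> 0"
  shows "s / (1 - r) \<in> {0..h}"
proof -
  have "s / (1 - r) \<le> s / 1"
    using assms by (intro divide_left_mono) auto
  then show ?thesis using assms by auto
qed

lemma segment_avoids_nonpos_Reals:
  assumes nz: "\<And>s. s \<in> {0..h} \<Longrightarrow> 1 + of_real s * z \<noteq> (0 :: complex)" and s: "s \<in> {0..h}"
  shows "1 + of_real s * z \<notin> \<real>\<^sub>\<le>\<^sub>0"
proof
  assume "1 + of_real s * z \<in> \<real>\<^sub>\<le>\<^sub>0"
  then obtain r where r: "1 + of_real s * z = of_real r" "r \<le> 0"
    by (auto simp: complex_nonpos_Reals_iff complex_eq_iff)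
  have "s / (1 - r) \<in> {0..h}"
    using s r(2) by (rule divide_one_minus_mem)
  from nz[OF this] segment_to_origin_nonpos[OF r] show False by simp
qed

text \<open>The scalar model of the matrix logarithm. It serves twice: for the correction \<eta>,
  and for reading off the eigenvalues of the matrix integral.\<close>

lemma has_integral_Ln_segment:
  fixes z :: complex
  assumes h: "0 \<le> h" and nz: "\<And>s. s \<in> {0..h} \<Longrightarrow> 1 + of_real s * z \<noteq> 0"
  shows "((\<lambda>s. z / (1 + of_real s * z)) has_integral Ln (1 + of_real h * z)) {0..h}"
proof -
  have "((\<lambda>s. Ln (1 + of_real s * z)) has_vector_derivative z / (1 + of_real s * z)) (at s within {0..h})"
    if s: "s \<in> {0..h}" for s
    using segment_avoids_nonpos_Reals[OF nz s]
    by (intro has_vector_derivative_real_field) (auto intro!: derivative_eq_intros simp: field_simps)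
  from fundamental_theorem_of_calculus[OF h this] show ?thesis by simp
qed

lemma matrix_inv_commute:
  assumes "invertible (A :: 'a::semiring_1^'n^'n)" "A ** C = C ** A"
  shows "matrix_inv A ** C = C ** matrix_inv A"
proof -
  have "matrix_inv A ** C = matrix_inv A ** (C ** A) ** matrix_inv A"
    using matrix_inv_mult(1)[OF assms(1)] by (simp flip: matrix_mul_assoc)
  also have "\<dots> = matrix_inv A ** A ** C ** matrix_inv A"
    by (simp add: matrix_mul_assoc flip: assms(2))
  also have "\<dots> = C ** matrix_inv A"
    using matrix_inv_mult(2)[OF assms(1)] by simp
  finally show ?thesis .
qed

lemma matrix_inv_eigenvector:
  fixes A :: "complex^'n^'n"
  assumes A: "invertible A" and "A *v v = c *s v" "v \<noteq> 0"
  shows "c \<noteq> 0" "matrix_inv A *v v = inverse c *s v"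
proof -
  have v: "v = c *s (matrix_inv A *v v)"
    by (simp add: scale_eq_cart matrix_vector_mul_assoc matrix_inv_mult[OF A] flip: assms(2))
  show "c \<noteq> 0" using v assms(3) by auto
  then show "matrix_inv A *v v = inverse c *s v"
    by (subst (2) v) simp
qed

lemma one_plus_scaleR_commute:
  fixes Z C :: "complex^'n^'n"
  shows "Z ** C = C ** Z \<Longrightarrow> (mat 1 + s *\<^sub>R Z) ** C = C ** (mat 1 + s *\<^sub>R Z)"
  by (simp add: matrix_mult.add_left matrix_mult.add_right matrix_mult.scaleR_left matrix_mult.scaleR_right)

section \<open>The logarithm along a segment of invertible matrices\<close>

locale matrix_segment =
  fixes Z :: "complex^'n^'n" and h :: real
  assumes h: "0 \<le> h"
    and inv: "\<And>s. s \<in> {0..h} \<Longrightarrow> invertible (mat 1 + s *\<^sub>R Z)"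
begin

text \<open>\<open>R\<close> is the logarithmic derivative of the path \<open>P\<close>, and
  \<open>L\<close> is its primitive vanishing at 0, the candidate for the logarithm of
  \<open>P\<close>.\<close>

definition P :: "real \<Rightarrow> complex^'n^'n" where "P s = mat 1 + s *\<^sub>R Z"
definition R :: "real \<Rightarrow> complex^'n^'n" where "R s = Z ** matrix_inv (P s)"
definition L :: "real \<Rightarrow> complex^'n^'n" where "L s = integral {0..s} R"

lemma invertible_P: "s \<in> {0..h} \<Longrightarrow> invertible (P s)"
  using inv by (simp add: P_def)

lemma continuous_on_R: "continuous_on {0..h} R"
proof -
  have "continuous_on {0..h} P" unfolding P_def by (intro continuous_intros)
  then show ?thesis
    unfolding R_def
    by (intro matrix_mult.continuous_on continuous_on_const continuous_on_matrix_inv invertible_P)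
qed

lemma integrable_R: "s \<in> {0..h} \<Longrightarrow> R integrable_on {0..s}"
  by (rule integrable_continuous_real, rule continuous_on_subset[OF continuous_on_R]) auto

lemma R_commute:
  assumes "Z ** C = C ** Z" "s \<in> {0..h}"
  shows "R s ** C = C ** R s"
proof -
  have "matrix_inv (P s) ** C = C ** matrix_inv (P s)"
    unfolding P_def by (intro matrix_inv_commute inv one_plus_scaleR_commute assms)
  then show ?thesis
    unfolding R_def by (metis assms(1) matrix_mul_assoc)
qed

text \<open>Stated for arbitrary C because three choices occur: Z itself, another value of
  \<open>L\<close>, and a competing logarithm.\<close>

lemma L_commute:
  assumes "Z ** C = C ** Z" "s \<in> {0..h}"
  shows "L s ** C = C ** L s"
proof -
  have "L s ** C = integral {0..s} (\<lambda>t. R t ** C)"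
    unfolding L_def
    using integral_linear[OF integrable_R[OF assms(2)] matrix_mult.bounded_linear_left[of C]]
    by (simp add: o_def)
  also have "\<dots> = integral {0..s} (\<lambda>t. C ** R t)"
    by (rule integral_cong) (use assms in \<open>auto intro: R_commute\<close>)
  also have "\<dots> = C ** L s"
    unfolding L_def
    using integral_linear[OF integrable_R[OF assms(2)] matrix_mult.bounded_linear_right[of C]]
    by (simp add: o_def)
  finally show ?thesis .
qed

lemma L_commute_L:
  assumes "s \<in> {0..h}" "t \<in> {0..h}"
  shows "L s ** L t = L t ** L s"
  by (intro L_commute assms) (use L_commute[of Z t] assms in auto)

lemma L_derivative:
  "s \<in> {0..h} \<Longrightarrow> (L has_vector_derivative R s) (at s within {0..h})"
  unfolding L_def by (rule integral_has_vector_derivative[OF continuous_on_R])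

text \<open>The product exp(-L) P is constant: the values of \<open>L\<close> commute, so its
  derivative is exp(-L) (Z - R P), and R P = Z. At 0 it equals 1.\<close>

lemma mat_exp_L: "mat_exp (L h) = P h"
proof -
  define F where "F s = exp (- to_sqmat (L s)) * to_sqmat (P s)" for s
  have F': "(F has_vector_derivative 0) (at s within {0..h})" if s: "s \<in> {0..h}" for s
  proof -
    have "((\<lambda>s. - to_sqmat (L s)) has_vector_derivative - to_sqmat (R s)) (at s within {0..h})"
      by (intro has_vector_derivative_minus
          bounded_linear.has_vector_derivative[OF bounded_linear_to_sqmat L_derivative] s)
    then have 1: "((\<lambda>s. exp (- to_sqmat (L s))) has_vector_derivative
        exp (- to_sqmat (L s)) * - to_sqmat (R s)) (at s within {0..h})"
      by (rule has_vector_derivative_exp_commuting[OF _ s])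
         (use L_commute_L s in \<open>simp add: times_sqmat.abs_eq\<close>)
    have "(P has_vector_derivative Z) (at s within {0..h})"
      unfolding P_def by (auto intro!: derivative_eq_intros)
    then have 2: "((\<lambda>s. to_sqmat (P s)) has_vector_derivative to_sqmat Z) (at s within {0..h})"
      by (rule bounded_linear.has_vector_derivative[OF bounded_linear_to_sqmat])
    have "R s ** P s = Z"
      using matrix_inv_mult[OF invertible_P[OF s]] by (simp add: R_def flip: matrix_mul_assoc)
    then have "to_sqmat (R s) * to_sqmat (P s) = to_sqmat Z"
      by (simp add: times_sqmat.abs_eq)
    then have "exp (- to_sqmat (L s)) * to_sqmat Z
        + exp (- to_sqmat (L s)) * - to_sqmat (R s) * to_sqmat (P s) = 0"
      by (simp add: mult.assoc)
    with has_vector_derivative_mult[OF 1 2] show ?thesis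
      unfolding F_def by simp
  qed
  have "F h = F 0"
  proof -
    obtain c where "\<And>s. s \<in> {0..h} \<Longrightarrow> F s = c"
      using has_vector_derivative_zero_constant[of "{0..h}" F] F' by auto
    then show ?thesis using h by simp
  qed
  also have "F 0 = 1"
    by (simp add: F_def L_def P_def one_sqmat_def times_sqmat.abs_eq flip: zero_sqmat_def)
  finally have "exp (to_sqmat (L h)) * (exp (- to_sqmat (L h)) * to_sqmat (P h)) = exp (to_sqmat (L h))"
    by (simp add: F_def)
  then have "exp (to_sqmat (L h)) = to_sqmat (P h)"
    by (simp add: exp_minus_inverse flip: mult.assoc)
  then show ?thesis
    using mat_exp_of_sqmat[of "to_sqmat (L h)"] by (simp add: to_sqmat_inverse)
qed

text \<open>Z preserves the eigenspace of \<open>L h\<close> for l, so it has an eigenvector there,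
  with some eigenvalue z. On that vector the matrix integral reduces to the scalar one, whence l =
  Ln (1 + hz) with an argument off the closed negative axis.\<close>

lemma L_eigenvalue_strip:
  assumes "mat_eigenvalue (L h) l"
  shows "- pi < Im l \<and> Im l < pi"
proof -
  obtain w where w: "w \<noteq> 0" "L h *v w = l *s w"
    using assms by (auto simp: mat_eigenvalue_iff)
  have LZ: "L h ** Z = Z ** L h"
    using h by (intro L_commute) auto
  have closed: "Z *v u \<in> {v. L h *v v = l *s v}" if "u \<in> {v. L h *v v = l *s v}" for u
  proof -
    have "L h *v (Z *v u) = Z *v (L h *v u)"
      by (simp add: matrix_vector_mul_assoc LZ)
    then show ?thesis using that by (simp add: scale_eq_cart)
  qed
  obtain v z where v: "L h *v v = l *s v" "v \<noteq> 0" "Z *v v = z *s v"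
    using exists_eigenvector_in_subspace[OF subspace_eigenspace closed _ w(1)] w(2) by auto
  have Pv: "P s *v v = (1 + of_real s * z) *s v" for s
    using v(3) by (simp add: P_def matrix_vector_mult.add_left matrix_vector_mult.scaleR_left
        vec.scale_left_distrib scaleR_eq_scale)
  have nz: "1 + of_real s * z \<noteq> 0" if "s \<in> {0..h}" for s
    using matrix_inv_eigenvector(1)[OF invertible_P Pv] that v(2) by blast
  have Rv: "R s *v v = (z / (1 + of_real s * z)) *s v" if "s \<in> {0..h}" for s
    using matrix_inv_eigenvector(2)[OF invertible_P[OF that] Pv v(2)] v(3)
    by (simp add: R_def divide_inverse mult.commute flip: matrix_vector_mul_assoc scale_eq_cart)
  have "((\<lambda>s. R s *v v) has_integral L h *v v) {0..h}"
    using has_integral_linear[OF integrable_integral[OF integrable_R[of h]]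
        matrix_vector_mult.bounded_linear_left[of v]] h by (simp add: o_def L_def)
  then have 1: "((\<lambda>s. (z / (1 + of_real s * z)) *s v) has_integral l *s v) {0..h}"
    unfolding v(1) by (rule has_integral_eq[rotated]) (rule Rv)
  from has_integral_linear[OF has_integral_Ln_segment[OF h nz] bounded_linear_scale]
  have "((\<lambda>s. (z / (1 + of_real s * z)) *s v) has_integral Ln (1 + of_real h * z) *s v) {0..h}"
    by (simp add: o_def)
  from has_integral_unique[OF 1 this] have "l = Ln (1 + of_real h * z)"
    using v(2) by simp
  moreover have "1 + of_real h * z \<notin> \<real>\<^sub>\<le>\<^sub>0"
    using segment_avoids_nonpos_Reals[of h z h] nz h by auto
  ultimately show ?thesis
    using Im_Ln_less_pi mpi_less_Im_Ln[of "1 + of_real h * z"] by force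
qed

lemma mat_log_eq_L: "mat_log (P h) = L h"
  unfolding mat_log_def
proof (rule the_equality)
  show "mat_exp (L h) = P h \<and> (\<forall>l. mat_eigenvalue (L h) l \<longrightarrow> - pi < Im l \<and> Im l < pi)"
    using mat_exp_L L_eigenvalue_strip by blast
  fix X :: "complex^'n^'n"
  assume X: "mat_exp X = P h \<and> (\<forall>l. mat_eigenvalue X l \<longrightarrow> - pi < Im l \<and> Im l < pi)"
  then have expX: "exp (to_sqmat X) = to_sqmat (P h)"
    using mat_exp_of_sqmat[of "to_sqmat X"] by (simp add: to_sqmat_inverse of_sqmat_inverse)
  have expL: "exp (to_sqmat (L h)) = to_sqmat (P h)"
    using mat_exp_L mat_exp_of_sqmat[of "to_sqmat (L h)"] by (simp add: to_sqmat_inverse of_sqmat_inverse)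
  have "P h ** X = X ** P h"
    using exp_times_arg_commute[of "to_sqmat X"]
    by (simp add: expX times_sqmat.abs_eq to_sqmat_inject)
  then have "h *\<^sub>R (Z ** X) = h *\<^sub>R (X ** Z)"
    by (simp add: P_def matrix_mult.add_left matrix_mult.add_right matrix_mult.scaleR_left matrix_mult.scaleR_right)
  \<comment> \<open>For h = 0 nothing is known about Z and X, but then \<open>L h\<close> is the
    zero matrix.\<close>
  then have "L h ** X = X ** L h"
    using L_commute[of X h] h by (cases "h = 0") (auto simp: L_def)
  then have "to_sqmat X * to_sqmat (L h) = to_sqmat (L h) * to_sqmat X"
    by (simp add: times_sqmat.abs_eq)
  from exp_inj_commuting[OF this] show "X = L h"
    using expX expL X L_eigenvalue_strip by (auto simp: to_sqmat_inverse to_sqmat_inject)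
qed

lemma mat_log_defined_P: "mat_log_defined (P h)"
  unfolding mat_log_defined_def
proof (intro allI impI notI)
  fix l assume "mat_eigenvalue (P h) l" and l: "Im l = 0 \<and> Re l \<le> 0"
  then obtain v where v: "v \<noteq> 0" "P h *v v = l *s v" by (auto simp: mat_eigenvalue_iff)
  define r where "r = Re l"
  have r: "r \<le> 0" "l = of_real r" using l by (auto simp: r_def complex_eq_iff)
  \<comment> \<open>The crossing parameter of \<open>segment_to_origin_nonpos\<close>, applied on an
    eigenvector: a nonpositive eigenvalue r of \<open>P h\<close> makes \<open>P s\<close>
    singular.\<close>
  define s where "s = h / (1 - r)"
  have "s \<in> {0..h}"
    unfolding s_def using h r by (intro divide_one_minus_mem) auto
  have "h *\<^sub>R (Z *v v) = (r - 1) *\<^sub>R v"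
    using v(2) by (simp add: P_def matrix_vector_mult.add_left matrix_vector_mult.scaleR_left r(2)
        scaleR_diff_left algebra_simps flip: scaleR_eq_scale)
  then have "s *\<^sub>R (Z *v v) = ((r - 1) / (1 - r)) *\<^sub>R v"
    unfolding s_def by (metis divide_inverse_commute scaleR_scaleR)
  also have "(r - 1) / (1 - r) = -1" using r by (simp add: field_simps)
  finally have "P s *v v = 0"
    by (simp add: P_def matrix_vector_mult.add_left matrix_vector_mult.scaleR_left)
  with invertible_P[OF \<open>s \<in> {0..h}\<close>] v(1) show False
    by (auto simp: invertible_iff_kernel)
qed

end

lemma
  fixes Z :: "complex^'n^'n"
  assumes "0 \<le> h" "\<And>s. s \<in> {0..h} \<Longrightarrow> invertible (mat 1 + s *\<^sub>R Z)"
  shows has_integral_mat_log_segment: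
    "((\<lambda>s. Z ** matrix_inv (mat 1 + s *\<^sub>R Z)) has_integral mat_log (mat 1 + h *\<^sub>R Z)) {0..h}"
    and mat_log_defined_segment: "mat_log_defined (mat 1 + h *\<^sub>R Z)"
proof -
  interpret matrix_segment Z h by unfold_locales (use assms in auto)
  show "mat_log_defined (mat 1 + h *\<^sub>R Z)"
    using mat_log_defined_P by (simp add: P_def)
  have "(R has_integral L h) {0..h}"
    unfolding L_def using assms by (intro integrable_integral integrable_R) auto
  then show "((\<lambda>s. Z ** matrix_inv (mat 1 + s *\<^sub>R Z)) has_integral mat_log (mat 1 + h *\<^sub>R Z)) {0..h}"
    using mat_log_eq_L by (simp add: R_def [abs_def] P_def)
qed

section \<open>Integrals of the resolvent over an arc\<close>

text \<open>The determinant is a polynomial in \<epsilon>. Unless it vanishes identically, its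
  finitely many roots do not accumulate at 0.\<close>

lemma eventually_invertible_add_mat:
  fixes M :: "complex^'n^'n"
  assumes "c \<noteq> 0"
  shows "\<forall>\<^sub>F \<epsilon> in at 0. invertible (M + mat (c * \<epsilon>))"
proof -
  define q :: "complex poly" where
    "q = (\<Sum>p | p permutes (UNIV::'n set). of_int (sign p) *
        (\<Prod>i\<in>UNIV. [:M $ i $ p i, if i = p i then c else 0:]))"
  have "poly [:M $ i $ j, if i = j then c else 0:] \<epsilon> = (M + mat (c * \<epsilon>)) $ i $ j" for i j \<epsilon>
    by (simp add: mat_def)
  then have q: "poly q \<epsilon> = det (M + mat (c * \<epsilon>))" for \<epsilon>
    by (simp add: q_def det_def poly_sum poly_prod del: poly_pCons)
  obtain K where K: "\<And>v. norm (M *v v) \<le> norm v * K"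
    using bounded_linear.bounded[OF matrix_vector_mult.bounded_linear_right[of M]] by blast
  \<comment> \<open>This \<epsilon> makes the added scalar equal to |K| + 1, larger than the bound K
    on the action of M, so the kernel is trivial and the polynomial is not zero.\<close>
  have "invertible (M + mat (c * (of_real (\<bar>K\<bar> + 1) / c)))"
    unfolding invertible_iff_kernel
  proof (intro allI impI)
    fix v assume "(M + mat (c * (of_real (\<bar>K\<bar> + 1) / c))) *v v = 0"
    then have "M *v v = - ((\<bar>K\<bar> + 1) *\<^sub>R v)"
      using \<open>c \<noteq> 0\<close> unfolding scaleR_eq_scale
      by (simp add: matrix_vector_mult.add_left mat_vector_mult eq_neg_iff_add_eq_0 del: of_real_add)
    then have "norm (M *v v) = (\<bar>K\<bar> + 1) * norm v" by simp
    with K[of v] have "(\<bar>K\<bar> + 1) * norm v \<le> K * norm v" by (simp add: mult.commute)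
    then have "(\<bar>K\<bar> + 1 - K) * norm v \<le> 0" by (simp add: algebra_simps)
    then show "v = 0"
      by (auto simp: mult_le_0_iff)
  qed
  then have "q \<noteq> 0"
    by (metis invertible_det_nz poly_0 q)
  then have "finite {\<epsilon>. poly q \<epsilon> = 0}" by (rule poly_roots_finite)
  then have "\<not> (0 islimpt {\<epsilon>. poly q \<epsilon> = 0})" by (rule islimpt_finite)
  then show ?thesis
    by (simp add: islimpt_iff_eventually q invertible_det_nz)
qed

lemma invertible_matrix_inv: "invertible (A :: 'a::semiring_1^'n^'n) \<Longrightarrow> invertible (matrix_inv A)"
  using matrix_inv_mult[of A] by (auto simp: invertible_def)

lemma matrix_inv_mult_matrix_inv:
  fixes X Y :: "'a::semiring_1^'n^'n"
  assumes X: "invertible X" and Y: "invertible Y"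
  shows "matrix_inv (X ** matrix_inv Y) = Y ** matrix_inv X"
    and "matrix_inv (matrix_inv Y ** X) = matrix_inv X ** Y"
proof -
  note inv = matrix_inv_mult[OF X] matrix_inv_mult[OF Y]
  have 1: "X ** matrix_inv Y ** (Y ** matrix_inv X) = mat 1"
    by (metis inv matrix_mul_assoc matrix_mul_rid)
  have 2: "Y ** matrix_inv X ** (X ** matrix_inv Y) = mat 1"
    by (metis inv matrix_mul_assoc matrix_mul_rid)
  show "matrix_inv (X ** matrix_inv Y) = Y ** matrix_inv X"
    using 1 2 by (rule matrix_inv_eqI)
  have 1: "matrix_inv Y ** X ** (matrix_inv X ** Y) = mat 1"
    by (metis inv matrix_mul_assoc matrix_mul_rid)
  have 2: "matrix_inv X ** Y ** (matrix_inv Y ** X) = mat 1"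
    by (metis inv matrix_mul_assoc matrix_mul_rid)
  show "matrix_inv (matrix_inv Y ** X) = matrix_inv X ** Y"
    using 1 2 by (rule matrix_inv_eqI)
qed

text \<open>Multiplied by cos (\<theta>/2), the first factor on the left is i e^(-i \<theta>/2) and
  the right side is i e^(i \<theta>/2). This is the Cayley transform from the line to the circle,
  cleared of its denominator.\<close>

lemma cayley_tan_half:
  assumes "- pi < \<theta>" "\<theta> < pi"
  shows "(of_real (tan (\<theta> / 2)) + \<i>) * exp (\<i> * of_real \<theta>) = \<i> - of_real (tan (\<theta> / 2))"
proof -
  have c: "cos (\<theta> / 2) \<noteq> 0"
    using cos_gt_zero_pi[of "\<theta> / 2"] assms by simp
  have e: "exp (\<i> * of_real \<theta>) = cis (\<theta> / 2) * cis (\<theta> / 2)"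
    by (simp add: cis_mult flip: cis_conv_exp)
  have "(Complex (sin (\<theta> / 2)) (cos (\<theta> / 2))) * (cis (\<theta> / 2) * cis (\<theta> / 2))
      = Complex (- sin (\<theta> / 2)) (cos (\<theta> / 2))"
    using sin_cos_squared_add[of "\<theta> / 2"]
    by (simp add: complex_eq_iff power2_eq_square) algebra
  moreover have "of_real (tan (\<theta> / 2)) + \<i> = Complex (sin (\<theta> / 2)) (cos (\<theta> / 2)) / of_real (cos (\<theta> / 2))"
    "\<i> - of_real (tan (\<theta> / 2)) = Complex (- sin (\<theta> / 2)) (cos (\<theta> / 2)) / of_real (cos (\<theta> / 2))"
    using c by (simp_all add: complex_eq_iff tan_def)
  ultimately show ?thesis by (simp add: e)
qed

lemma tan_half_derivative:
  assumes "- pi < \<theta>" "\<theta> < pi"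
  shows "((\<lambda>\<theta>. tan (\<theta> / 2) - c) has_field_derivative (1 + (tan (\<theta> / 2))\<^sup>2) / 2) (at \<theta> within S)"
proof -
  have c: "cos (\<theta> / 2) \<noteq> 0"
    using cos_gt_zero_pi[of "\<theta> / 2"] assms by simp
  then show ?thesis
    by (auto intro!: derivative_eq_intros simp: tan_sec power_inverse)
qed

text \<open>The matrices are complex and arbitrary because the locale is instantiated with the
  perturbed pencil, for each \<epsilon> separately.\<close>

locale pencil_arc =
  fixes A E :: "complex^'n^'n" and \<theta>1 \<theta>2 :: real
  assumes theta: "- pi < \<theta>1" "\<theta>1 \<le> \<theta>2" "\<theta>2 < pi"
    and regular: "\<And>\<theta>. \<theta> \<in> {\<theta>1..\<theta>2} \<Longrightarrow> invertible (mat (exp (\<i> * of_real \<theta>)) ** E - A)"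
begin

definition Q :: "real \<Rightarrow> complex^'n^'n" where "Q \<theta> = mat (exp (\<i> * of_real \<theta>)) ** E - A"
definition G :: "real \<Rightarrow> complex^'n^'n" where
  "G t = mat (of_real t) ** (E + A) - mat \<i> ** (E - A)"
definition t1 :: real where "t1 = tan (\<theta>1 / 2)"
definition t2 :: real where "t2 = tan (\<theta>2 / 2)"
definition \<eta> :: complex where "\<eta> = Ln ((of_real t2 - \<i>) / (of_real t1 - \<i>))"

lemma of_real_minus_i: "of_real t - \<i> \<noteq> 0" "\<i> - of_real t \<noteq> 0"
  by (simp_all add: complex_eq_iff)

lemma t1_le_t2: "t1 \<le> t2"
  unfolding t1_def t2_def using theta by (cases "\<theta>1 = \<theta>2") (auto intro!: less_imp_le tan_monotone)

lemma tan_half_mem: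
  assumes "\<theta> \<in> {\<theta>1..\<theta>2}"
  shows "tan (\<theta> / 2) \<in> {t1..t2}"
proof -
  have mono: "tan (x / 2) \<le> tan (y / 2)" if "- pi < x" "x \<le> y" "y < pi" for x y
    using that by (cases "x = y") (auto intro!: less_imp_le tan_monotone)
  show ?thesis
    unfolding t1_def t2_def using assms theta by (auto intro!: mono)
qed

text \<open>Collecting terms, G t = (t - i) E + (t + i) A, and the Cayley identity turns e^(i
  \<theta>) (t + i) into -(t - i); the common factor t - i then comes out.\<close>

lemma Q_eq_G:
  assumes "\<theta> \<in> {\<theta>1..\<theta>2}" and t: "t = tan (\<theta> / 2)"
  shows "Q \<theta> = mat (exp (\<i> * of_real \<theta>) / (of_real t - \<i>)) ** G t"
proof -
  have c: "(of_real t + \<i>) * exp (\<i> * of_real \<theta>) = \<i> - of_real t"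
    unfolding t using cayley_tan_half[of \<theta>] assms theta by auto
  have "exp (\<i> * of_real \<theta>) * x - y
      = exp (\<i> * of_real \<theta>) / (of_real t - \<i>) * (of_real t * (x + y) - \<i> * (x - y))" for x y
  proof -
    have "exp (\<i> * of_real \<theta>) * (of_real t * (x + y) - \<i> * (x - y))
        = exp (\<i> * of_real \<theta>) * (of_real t - \<i>) * x + ((of_real t + \<i>) * exp (\<i> * of_real \<theta>)) * y"
      by (simp add: algebra_simps)
    also have "\<dots> = (of_real t - \<i>) * (exp (\<i> * of_real \<theta>) * x - y)"
      unfolding c by (simp add: algebra_simps)
    finally show ?thesis using of_real_minus_i[of t] by (simp add: divide_simps mult.commute)
  qed
  then show ?thesis
    by (simp add: Q_def G_def vec_eq_iff mat_matrix_mult_nth)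
qed

lemma invertible_G:
  assumes "t \<in> {t1..t2}"
  shows "invertible (G t)"
proof -
  \<comment> \<open>Every t between the end values comes from an angle on the arc, so regularity on
    the arc covers the whole segment.\<close>
  define \<theta> where "\<theta> = 2 * arctan t"
  have t: "t = tan (\<theta> / 2)" by (simp add: \<theta>_def tan_arctan)
  have "arctan t1 \<le> arctan t" "arctan t \<le> arctan t2"
    using assms by (auto simp: arctan_le_iff)
  then have \<theta>: "\<theta> \<in> {\<theta>1..\<theta>2}"
    using theta by (simp add: \<theta>_def t1_def t2_def arctan_tan)
  have "invertible (mat (exp (\<i> * of_real \<theta>) / (of_real t - \<i>)) ** G t)"
    using regular[OF \<theta>] unfolding Q_def[symmetric] Q_eq_G[OF \<theta> t] by simp
  then show ?thesis
    unfolding invertible_iff_kernel by (metis matrix_vector_mul_assoc matrix_vector_mult_0_right)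
qed

lemma G_shift: "G (t1 + s) = G t1 + s *\<^sub>R (E + A)"
  by (simp add: G_def vec_eq_iff mat_matrix_mult_nth) (simp add: scaleR_conv_of_real algebra_simps)

lemma continuous_on_inv_G: "continuous_on {0..t2 - t1} (\<lambda>s. matrix_inv (G (t1 + s)))"
proof (rule continuous_on_matrix_inv)
  show "continuous_on {0..t2 - t1} (\<lambda>s. G (t1 + s))"
    unfolding G_shift by (intro continuous_intros)
qed (auto intro!: invertible_G)

text \<open>The scalar segment with z = 1/(t1 - i): then 1 + sz = (t1 + s - i)/(t1 - i), which has
  no zero since t1 + s is real.\<close>

lemma has_integral_eta:
  "((\<lambda>s. mat (1 / (of_real (t1 + s) - \<i>)) :: complex^'n^'n) has_integral mat \<eta>) {0..t2 - t1}"
proof -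
  let ?z = "1 / (of_real t1 - \<i>)"
  have eq: "1 + of_real s * ?z = (of_real (t1 + s) - \<i>) / (of_real t1 - \<i>)" for s
    using of_real_minus_i[of t1] by (simp add: divide_simps)
  have "((\<lambda>s. ?z / (1 + of_real s * ?z)) has_integral Ln (1 + of_real (t2 - t1) * ?z)) {0..t2 - t1}"
  proof (rule has_integral_Ln_segment)
    show "1 + of_real s * ?z \<noteq> 0" for s
      unfolding eq divide_eq_0_iff using of_real_minus_i(1) by blast
  qed (use t1_le_t2 in simp)
  then have "((\<lambda>s. 1 / (of_real (t1 + s) - \<i>)) has_integral \<eta>) {0..t2 - t1}"
    unfolding eq using of_real_minus_i[of t1] by (simp add: \<eta>_def)
  from has_integral_linear[OF this bounded_linear_mat] show ?thesis by (simp add: o_def)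
qed

lemma tan_half_substitution:
  fixes f :: "real \<Rightarrow> complex^'n^'n"
  assumes "(f has_integral I) {0..t2 - t1}" "continuous_on {0..t2 - t1} f"
  shows "((\<lambda>\<theta>. ((1 + (tan (\<theta> / 2))\<^sup>2) / 2) *\<^sub>R f (tan (\<theta> / 2) - t1)) has_integral I) {\<theta>1..\<theta>2}"
proof -
  have "((\<lambda>\<theta>. ((1 + (tan (\<theta> / 2))\<^sup>2) / 2) *\<^sub>R f (tan (\<theta> / 2) - t1)) has_integral
      integral {tan (\<theta>1 / 2) - t1..tan (\<theta>2 / 2) - t1} f) {\<theta>1..\<theta>2}"
  proof (rule has_integral_substitution[where c = 0 and d = "t2 - t1"])
    show "(\<lambda>\<theta>. tan (\<theta> / 2) - t1) ` {\<theta>1..\<theta>2} \<subseteq> {0..t2 - t1}"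
      using tan_half_mem by auto
    show "((\<lambda>\<theta>. tan (\<theta> / 2) - t1) has_field_derivative (1 + (tan (x / 2))\<^sup>2) / 2) (at x within {\<theta>1..\<theta>2})"
      if "x \<in> {\<theta>1..\<theta>2}" for x
      using that theta by (intro tan_half_derivative) auto
  qed (use theta t1_le_t2 assms in \<open>auto simp: t1_def t2_def\<close>)
  also have "integral {tan (\<theta>1 / 2) - t1..tan (\<theta>2 / 2) - t1} f = I"
    using assms(1) by (simp add: t1_def t2_def integral_unique)
  finally show ?thesis .
qed

text \<open>Here x and y stand for entries of E and A. The difference of the two terms collapses to
  (e^(i \<theta>) + 1) y/(t - i); with 1 + t^2 = (t - i)(t + i) and the Cayley identity, the terms
  in t cancel and i y remains. The scalar term subtracted is exactly what removes x.\<close>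

lemma cayley_entry:
  assumes \<theta>: "\<theta> \<in> {\<theta>1..\<theta>2}" and t: "t = tan (\<theta> / 2)"
  shows "of_real ((1 + t\<^sup>2) / 2) * (exp (\<i> * of_real \<theta>) / (of_real t - \<i>) * (x + y)
      - 1 / (of_real t - \<i>) * (exp (\<i> * of_real \<theta>) * x - y)) = \<i> * y"
proof -
  let ?e = "exp (\<i> * of_real \<theta>)"
  have c: "(of_real t + \<i>) * ?e = \<i> - of_real t"
    unfolding t using cayley_tan_half[of \<theta>] assms theta by auto
  have f: "of_real ((1 + t\<^sup>2) / 2) = (of_real t - \<i>) * (of_real t + \<i>) / 2"
    by (simp add: algebra_simps power2_eq_square)
  have "?e / (of_real t - \<i>) * (x + y) - 1 / (of_real t - \<i>) * (?e * x - y)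
      = (?e + 1) * y / (of_real t - \<i>)"
    using of_real_minus_i[of t] by (simp add: divide_simps) (simp add: algebra_simps)
  moreover have "b * d / 2 * ((e + 1) * y / b) = (d * e + d) / 2 * y" if "b \<noteq> 0" for b d e :: complex
    using that by (simp add: field_simps)
  ultimately have "of_real ((1 + t\<^sup>2) / 2) * (?e / (of_real t - \<i>) * (x + y)
      - 1 / (of_real t - \<i>) * (?e * x - y)) = ((of_real t + \<i>) * ?e + (of_real t + \<i>)) / 2 * y"
    unfolding f using of_real_minus_i(1)[of t] by metis
  then show ?thesis by (simp add: c)
qed

text \<open>Since \<open>Q\<close> is a scalar multiple of \<open>G\<close>, multiplying by
  \<open>Q\<close> from the right clears both inverses and leaves scalar combinations of E and A,
  compared entry by entry through \<open>cayley_entry\<close>.\<close>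

lemma integrand_left:
  assumes \<theta>: "\<theta> \<in> {\<theta>1..\<theta>2}" and t: "t = tan (\<theta> / 2)"
  shows "((1 + t\<^sup>2) / 2) *\<^sub>R ((E + A) ** matrix_inv (G t) - mat (1 / (of_real t - \<i>)))
      = mat \<i> ** A ** matrix_inv (Q \<theta>)" (is "?X = _")
proof -
  have Q: "invertible (Q \<theta>)" using regular[OF \<theta>] by (simp add: Q_def)
  have G: "invertible (G t)" using tan_half_mem[OF \<theta>] by (simp add: t invertible_G)
  let ?k = "exp (\<i> * of_real \<theta>) / (of_real t - \<i>)"
  have "matrix_inv (G t) ** Q \<theta> = matrix_inv (G t) ** (G t ** mat ?k)"
    by (simp add: Q_eq_G[OF \<theta> t] mat_mult_commute)
  then have "matrix_inv (G t) ** Q \<theta> = mat ?k"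
    by (simp add: matrix_mul_assoc matrix_inv_mult[OF G])
  then have "?X ** Q \<theta> = of_real ((1 + t\<^sup>2) / 2) *\<^sub>R (mat ?k ** (E + A) - mat (1 / (of_real t - \<i>)) ** Q \<theta>)"
    by (simp add: matrix_mult.scaleR_left matrix_mult.diff_left mat_mult_commute flip: matrix_mul_assoc)
  also have "\<dots> = mat \<i> ** A"
    using cayley_entry[OF \<theta> t]
    by (simp add: vec_eq_iff mat_matrix_mult_nth Q_def) (simp add: scaleR_conv_of_real)
  finally have "?X ** (Q \<theta> ** matrix_inv (Q \<theta>)) = mat \<i> ** A ** matrix_inv (Q \<theta>)"
    by (simp add: matrix_mul_assoc)
  then show ?thesis by (simp add: matrix_inv_mult[OF Q])
qed

lemma integrand_right:
  assumes \<theta>: "\<theta> \<in> {\<theta>1..\<theta>2}" and t: "t = tan (\<theta> / 2)"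
  shows "((1 + t\<^sup>2) / 2) *\<^sub>R (matrix_inv (G t) ** (E + A) - mat (1 / (of_real t - \<i>)))
      = matrix_inv (Q \<theta>) ** (mat \<i> ** A)" (is "?X = _")
proof -
  have Q: "invertible (Q \<theta>)" using regular[OF \<theta>] by (simp add: Q_def)
  have G: "invertible (G t)" using tan_half_mem[OF \<theta>] by (simp add: t invertible_G)
  let ?k = "exp (\<i> * of_real \<theta>) / (of_real t - \<i>)"
  have "Q \<theta> ** matrix_inv (G t) = mat ?k"
    by (simp add: Q_eq_G[OF \<theta> t] matrix_inv_mult[OF G] flip: matrix_mul_assoc)
  then have "Q \<theta> ** ?X = of_real ((1 + t\<^sup>2) / 2) *\<^sub>R (mat ?k ** (E + A) - mat (1 / (of_real t - \<i>)) ** Q \<theta>)"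
    by (simp add: matrix_mult.scaleR_right matrix_mult.diff_right mat_mult_commute matrix_mul_assoc)
  also have "\<dots> = mat \<i> ** A"
    using cayley_entry[OF \<theta> t]
    by (simp add: vec_eq_iff mat_matrix_mult_nth Q_def) (simp add: scaleR_conv_of_real)
  finally have "matrix_inv (Q \<theta>) ** Q \<theta> ** ?X = matrix_inv (Q \<theta>) ** (mat \<i> ** A)"
    by (simp flip: matrix_mul_assoc)
  then show ?thesis by (simp add: matrix_inv_mult[OF Q])
qed

text \<open>Both quotients are segments starting at I, but with different directions Z, as E + A and
  the inverse of \<open>G t1\<close> need not commute. This is why there is a left and a right
  formula.\<close>

lemma G_mult_inv_G:
  assumes "s \<in> {0..t2 - t1}"
  shows "mat 1 + s *\<^sub>R ((E + A) ** matrix_inv (G t1)) = G (t1 + s) ** matrix_inv (G t1)"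
    and "mat 1 + s *\<^sub>R (matrix_inv (G t1) ** (E + A)) = matrix_inv (G t1) ** G (t1 + s)"
    and "invertible (G (t1 + s) ** matrix_inv (G t1))"
    and "invertible (matrix_inv (G t1) ** G (t1 + s))"
proof -
  have G: "invertible (G t1)" "invertible (G (t1 + s))"
    using assms t1_le_t2 by (auto intro!: invertible_G)
  show "mat 1 + s *\<^sub>R ((E + A) ** matrix_inv (G t1)) = G (t1 + s) ** matrix_inv (G t1)"
    "mat 1 + s *\<^sub>R (matrix_inv (G t1) ** (E + A)) = matrix_inv (G t1) ** G (t1 + s)"
    by (simp_all add: G_shift matrix_mult.add_left[of "G t1"] matrix_mult.add_right[of _ "G t1"]
        matrix_mult.scaleR_left matrix_mult.scaleR_right matrix_inv_mult[OF G(1)])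
  show "invertible (G (t1 + s) ** matrix_inv (G t1))" "invertible (matrix_inv (G t1) ** G (t1 + s))"
    by (intro invertible_mult invertible_matrix_inv G)+
qed

lemma mat_log_defined_left: "mat_log_defined (G t2 ** matrix_inv (G t1))"
  and has_integral_left:
    "((\<lambda>\<theta>. mat \<i> ** A ** matrix_inv (Q \<theta>)) has_integral
      - mat \<eta> + mat_log (G t2 ** matrix_inv (G t1))) {\<theta>1..\<theta>2}"
proof -
  let ?Z = "(E + A) ** matrix_inv (G t1)"
  have h: "0 \<le> t2 - t1" "t2 - t1 \<in> {0..t2 - t1}" using t1_le_t2 by auto
  have inv: "invertible (mat 1 + s *\<^sub>R ?Z)" if "s \<in> {0..t2 - t1}" for s
    using G_mult_inv_G[OF that] by simp
  have end_: "mat 1 + (t2 - t1) *\<^sub>R ?Z = G t2 ** matrix_inv (G t1)"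
    using G_mult_inv_G(1)[OF h(2)] by simp
  show "mat_log_defined (G t2 ** matrix_inv (G t1))"
    unfolding end_[symmetric] by (rule mat_log_defined_segment[OF h(1) inv])
  \<comment> \<open>The inverse of I + sZ is G(t1) G(t1 + s)^(-1), and its first factor cancels
    against the last factor of Z.\<close>
  have R: "?Z ** matrix_inv (mat 1 + s *\<^sub>R ?Z) = (E + A) ** matrix_inv (G (t1 + s))"
    if s: "s \<in> {0..t2 - t1}" for s
  proof -
    have G: "invertible (G t1)" "invertible (G (t1 + s))"
      using s t1_le_t2 by (auto intro!: invertible_G)
    have "?Z ** matrix_inv (mat 1 + s *\<^sub>R ?Z)
        = (E + A) ** (matrix_inv (G t1) ** G t1) ** matrix_inv (G (t1 + s))"
      by (simp add: G_mult_inv_G(1)[OF s] matrix_inv_mult_matrix_inv[OF G(2,1)] matrix_mul_assoc)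
    then show ?thesis by (simp add: matrix_inv_mult[OF G(1)])
  qed
  have "((\<lambda>s. (E + A) ** matrix_inv (G (t1 + s))) has_integral mat_log (G t2 ** matrix_inv (G t1)))
      {0..t2 - t1}"
    unfolding end_[symmetric]
    by (rule has_integral_eq[OF R has_integral_mat_log_segment[OF h(1) inv]])
  from has_integral_diff[OF this has_integral_eta]
  have "((\<lambda>\<theta>. ((1 + (tan (\<theta> / 2))\<^sup>2) / 2) *\<^sub>R ((E + A) ** matrix_inv (G (t1 + (tan (\<theta> / 2) - t1)))
        - mat (1 / (of_real (t1 + (tan (\<theta> / 2) - t1)) - \<i>)))) has_integral
      mat_log (G t2 ** matrix_inv (G t1)) - mat \<eta>) {\<theta>1..\<theta>2}"
    by (rule tan_half_substitution)
       (intro continuous_intros matrix_mult.continuous_on continuous_on_inv_G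
          bounded_linear.continuous_on[OF bounded_linear_mat] ballI of_real_minus_i)
  then have "((\<lambda>\<theta>. mat \<i> ** A ** matrix_inv (Q \<theta>)) has_integral
      mat_log (G t2 ** matrix_inv (G t1)) - mat \<eta>) {\<theta>1..\<theta>2}"
    by (rule has_integral_eq[rotated]) (use integrand_left in simp)
  then show "((\<lambda>\<theta>. mat \<i> ** A ** matrix_inv (Q \<theta>)) has_integral
      - mat \<eta> + mat_log (G t2 ** matrix_inv (G t1))) {\<theta>1..\<theta>2}"
    by simp
qed

lemma mat_log_defined_right: "mat_log_defined (matrix_inv (G t1) ** G t2)"
  and has_integral_right:
    "((\<lambda>\<theta>. matrix_inv (Q \<theta>) ** (mat \<i> ** A)) has_integral
      - mat \<eta> + mat_log (matrix_inv (G t1) ** G t2)) {\<theta>1..\<theta>2}"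
proof -
  let ?Z = "matrix_inv (G t1) ** (E + A)"
  have h: "0 \<le> t2 - t1" "t2 - t1 \<in> {0..t2 - t1}" using t1_le_t2 by auto
  have inv: "invertible (mat 1 + s *\<^sub>R ?Z)" if "s \<in> {0..t2 - t1}" for s
    using G_mult_inv_G[OF that] by simp
  have end_: "mat 1 + (t2 - t1) *\<^sub>R ?Z = matrix_inv (G t1) ** G t2"
    using G_mult_inv_G(2)[OF h(2)] by simp
  show "mat_log_defined (matrix_inv (G t1) ** G t2)"
    unfolding end_[symmetric] by (rule mat_log_defined_segment[OF h(1) inv])
  have R: "?Z ** matrix_inv (mat 1 + s *\<^sub>R ?Z) = matrix_inv (G (t1 + s)) ** (E + A)"
    if s: "s \<in> {0..t2 - t1}" for s
  proof -
    have G: "invertible (G t1)" "invertible (G (t1 + s))"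
      using s t1_le_t2 by (auto intro!: invertible_G)
    \<comment> \<open>Z has to be moved to the other side first, since only there do
      \<open>G t1\<close> and its inverse become adjacent.\<close>
    have "?Z ** matrix_inv (mat 1 + s *\<^sub>R ?Z) = matrix_inv (mat 1 + s *\<^sub>R ?Z) ** ?Z"
      by (rule matrix_inv_commute[symmetric, OF inv[OF s] one_plus_scaleR_commute[OF refl]])
    also have "\<dots> = matrix_inv (G (t1 + s)) ** (G t1 ** matrix_inv (G t1)) ** (E + A)"
      by (simp add: G_mult_inv_G(2)[OF s] matrix_inv_mult_matrix_inv[OF G(2,1)] matrix_mul_assoc)
    finally show ?thesis by (simp add: matrix_inv_mult[OF G(1)])
  qed
  have "((\<lambda>s. matrix_inv (G (t1 + s)) ** (E + A)) has_integral mat_log (matrix_inv (G t1) ** G t2))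
      {0..t2 - t1}"
    unfolding end_[symmetric]
    by (rule has_integral_eq[OF R has_integral_mat_log_segment[OF h(1) inv]])
  from has_integral_diff[OF this has_integral_eta]
  have "((\<lambda>\<theta>. ((1 + (tan (\<theta> / 2))\<^sup>2) / 2) *\<^sub>R (matrix_inv (G (t1 + (tan (\<theta> / 2) - t1))) ** (E + A)
        - mat (1 / (of_real (t1 + (tan (\<theta> / 2) - t1)) - \<i>)))) has_integral
      mat_log (matrix_inv (G t1) ** G t2) - mat \<eta>) {\<theta>1..\<theta>2}"
    by (rule tan_half_substitution)
       (intro continuous_intros matrix_mult.continuous_on continuous_on_inv_G
          bounded_linear.continuous_on[OF bounded_linear_mat] ballI of_real_minus_i)
  then have "((\<lambda>\<theta>. matrix_inv (Q \<theta>) ** (mat \<i> ** A)) has_integral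
      mat_log (matrix_inv (G t1) ** G t2) - mat \<eta>) {\<theta>1..\<theta>2}"
    by (rule has_integral_eq[rotated]) (use integrand_right in simp)
  then show "((\<lambda>\<theta>. matrix_inv (Q \<theta>) ** (mat \<i> ** A)) has_integral
      - mat \<eta> + mat_log (matrix_inv (G t1) ** G t2)) {\<theta>1..\<theta>2}"
    by simp
qed

lemma integral_left:
  assumes "invertible A"
  shows "mat (inverse \<i>) ** matrix_inv A ** (- mat \<eta> + mat_log (G t2 ** matrix_inv (G t1)))
      = integral {\<theta>1..\<theta>2} (\<lambda>\<theta>. matrix_inv (Q \<theta>))"
proof -
  have "mat (inverse \<i>) ** matrix_inv A ** (mat \<i> ** A ** X) = X" for X :: "complex^'n^'n"
  proof -
    have "mat (inverse \<i>) ** matrix_inv A ** (mat \<i> ** A ** X)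
        = mat (inverse \<i>) ** (matrix_inv A ** mat \<i>) ** A ** X"
      by (simp add: matrix_mul_assoc)
    also have "\<dots> = mat (inverse \<i>) ** mat \<i> ** (matrix_inv A ** A) ** X"
      unfolding mat_mult_commute[of \<i> "matrix_inv A", symmetric] by (simp only: matrix_mul_assoc)
    finally show ?thesis by (simp add: mat_mult_mat matrix_inv_mult[OF assms])
  qed
  with has_integral_linear[OF has_integral_left
      matrix_mult.bounded_linear_right[of "mat (inverse \<i>) ** matrix_inv A"]]
  show ?thesis by (simp add: o_def integral_unique)
qed

lemma integral_right:
  assumes "invertible A"
  shows "mat (inverse \<i>) ** (- mat \<eta> + mat_log (matrix_inv (G t1) ** G t2)) ** matrix_inv A
      = integral {\<theta>1..\<theta>2} (\<lambda>\<theta>. matrix_inv (Q \<theta>))"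
proof -
  have "X ** (mat \<i> ** A) ** (mat (inverse \<i>) ** matrix_inv A) = X" for X :: "complex^'n^'n"
  proof -
    have "X ** (mat \<i> ** A) ** (mat (inverse \<i>) ** matrix_inv A)
        = X ** mat \<i> ** (A ** mat (inverse \<i>)) ** matrix_inv A"
      by (simp add: matrix_mul_assoc)
    also have "\<dots> = X ** (mat \<i> ** mat (inverse \<i>)) ** (A ** matrix_inv A)"
      unfolding mat_mult_commute[of "inverse \<i>" A, symmetric] by (simp only: matrix_mul_assoc)
    finally show ?thesis by (simp add: mat_mult_mat matrix_inv_mult[OF assms])
  qed
  moreover have "mat (inverse \<i>) ** Y ** matrix_inv A = Y ** (mat (inverse \<i>) ** matrix_inv A)"
    for Y :: "complex^'n^'n"
    by (simp add: mat_mult_commute[of _ Y] matrix_mul_assoc)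
  ultimately show ?thesis
    using has_integral_linear[OF has_integral_right
      matrix_mult.bounded_linear_left[of "mat (inverse \<i>) ** matrix_inv A"]]
    by (simp add: o_def integral_unique)
qed

end

section \<open>Letting the perturbation vanish\<close>

theorem theorem2:
  fixes A E :: "real^'n^'n" and \<alpha> \<beta> :: complex and \<theta>1 \<theta>2 :: real
  assumes "regular_pencil (cmat A) (cmat E)"
    and "invertible (mat \<alpha> ** cmat E + mat \<beta> ** cmat A)"
    and "-pi < \<theta>1" "\<theta>1 < pi" "-pi < \<theta>2" "\<theta>2 < pi" "\<theta>1 \<le> \<theta>2"
    and "\<forall>\<phi>::real. wrap \<phi> \<in> {\<theta>1..\<theta>2} \<longrightarrow>
           \<not> pencil_eigenvalue (cmat A) (cmat E) (exp (\<i> * complex_of_real \<phi>))"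
  shows
    "let K = (\<lambda>z::complex. matrix_inv (mat z ** cmat E - cmat A));
         Aeps = (\<lambda>\<epsilon>::complex. cmat A + mat (\<alpha> * \<epsilon>));
         Eeps = (\<lambda>\<epsilon>::complex. cmat E - mat (\<beta> * \<epsilon>));
         \<Gamma> = (\<lambda>\<theta>::real. \<lambda>\<epsilon>::complex.
                mat (complex_of_real (tan (\<theta> / 2))) ** (Eeps \<epsilon> + Aeps \<epsilon>)
                - mat \<i> ** (Eeps \<epsilon> - Aeps \<epsilon>));
         \<eta> = Ln ((complex_of_real (tan (\<theta>2 / 2)) - \<i>) / (complex_of_real (tan (\<theta>1 / 2)) - \<i>));
         I = integral {\<theta>1..\<theta>2} (\<lambda>\<theta>. K (exp (\<i> * complex_of_real \<theta>)))
     in (\<forall>\<^sub>F \<epsilon> in at 0. invertible (Aeps \<epsilon>) \<and> invertible (\<Gamma> \<theta>1 \<epsilon>) \<and> invertible (\<Gamma> \<theta>2 \<epsilon>)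
            \<and> mat_log_defined (\<Gamma> \<theta>2 \<epsilon> ** matrix_inv (\<Gamma> \<theta>1 \<epsilon>))
            \<and> mat_log_defined (matrix_inv (\<Gamma> \<theta>1 \<epsilon>) ** \<Gamma> \<theta>2 \<epsilon>))
      \<and> ((\<lambda>\<epsilon>. mat (inverse \<i>) ** matrix_inv (Aeps \<epsilon>)
             ** (- mat \<eta> + mat_log (\<Gamma> \<theta>2 \<epsilon> ** matrix_inv (\<Gamma> \<theta>1 \<epsilon>)))) \<longlongrightarrow> I) (at 0)
      \<and> ((\<lambda>\<epsilon>. mat (inverse \<i>) ** (- mat \<eta> + mat_log (matrix_inv (\<Gamma> \<theta>1 \<epsilon>) ** \<Gamma> \<theta>2 \<epsilon>))
             ** matrix_inv (Aeps \<epsilon>)) \<longlongrightarrow> I) (at 0)"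
proof -
  \<comment> \<open>Taken as one function of the pair (\<epsilon>, \<theta>), so that openness and
    compactness can be used jointly.\<close>
  define H where "H = (\<lambda>(\<epsilon>, \<theta>). mat (exp (\<i> * of_real \<theta>)) ** (cmat E - mat (\<beta> * \<epsilon>)) - (cmat A + mat (\<alpha> * \<epsilon>)))"
  define J where "J \<epsilon> = integral {\<theta>1..\<theta>2} (\<lambda>\<theta>. matrix_inv (H (\<epsilon>, \<theta>)))" for \<epsilon>
  have contH: "continuous_on UNIV H"
    unfolding H_def case_prod_unfold
    by (intro continuous_intros matrix_mult.continuous_on bounded_linear.continuous_on[OF bounded_linear_mat])
  have H0: "invertible (H (0, \<theta>))" if "\<theta> \<in> {\<theta>1..\<theta>2}" for \<theta>
  proof -
    have "wrap \<theta> = \<theta>"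
      using that assms(3-6) by (simp add: wrap_def Arg_exp)
    with assms(8) that have "invertible (cmat A - mat (exp (\<i> * of_real \<theta>)) ** cmat E)"
      by (simp add: pencil_eigenvalue_def invertible_det_nz)
    then show ?thesis
      by (auto simp: H_def invertible_iff_kernel matrix_vector_mult_diff_rdistrib)
  qed
  \<comment> \<open>Tube argument: invertibility is an open condition that holds on the compact set
    {0} x arc, hence on a neighbourhood of uniform radius. One bound on \<epsilon> thus serves all
    angles.\<close>
  have "open {x. det (H x) \<noteq> 0}"
    by (intro open_Collect_neq continuous_on_det contH continuous_on_const)
  moreover have "{0} \<times> {\<theta>1..\<theta>2} \<subseteq> {x. det (H x) \<noteq> 0}"
    using H0 by (auto simp: invertible_det_nz)
  moreover have "compact ({0 :: complex} \<times> {\<theta>1..\<theta>2})"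
    by (intro compact_Times) auto
  ultimately obtain r where r: "r > 0" "(\<Union>x\<in>{0} \<times> {\<theta>1..\<theta>2}. ball x r) \<subseteq> {x. det (H x) \<noteq> 0}"
    using compact_subset_open_imp_ball_epsilon_subset by metis
  have H: "invertible (H (\<epsilon>, \<theta>))" if "\<epsilon> \<in> ball 0 r" "\<theta> \<in> {\<theta>1..\<theta>2}" for \<epsilon> \<theta>
  proof -
    have "(\<epsilon>, \<theta>) \<in> ball (0, \<theta>) r"
      using that by (simp add: dist_Pair_Pair)
    then show ?thesis using r(2) that unfolding invertible_det_nz by blast
  qed
  have "continuous_on (ball 0 r) (\<lambda>\<epsilon>. integral (cbox \<theta>1 \<theta>2) (\<lambda>\<theta>. matrix_inv (H (\<epsilon>, \<theta>))))"
  proof (rule integral_continuous_on_param[of "ball 0 r" \<theta>1 \<theta>2 "\<lambda>\<epsilon> \<theta>. matrix_inv (H (\<epsilon>, \<theta>))"])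
    have "continuous_on (ball 0 r \<times> cbox \<theta>1 \<theta>2) (\<lambda>x. matrix_inv (H x))"
      using H by (intro continuous_on_matrix_inv continuous_on_subset[OF contH]) auto
    then show "continuous_on (ball 0 r \<times> cbox \<theta>1 \<theta>2) (\<lambda>(\<epsilon>, \<theta>). matrix_inv (H (\<epsilon>, \<theta>)))"
      by (simp add: case_prod_unfold)
  qed
  then have "isCont J 0"
    using r(1) by (simp add: J_def [abs_def] continuous_on_eq_continuous_at)
  then have lim: "(J \<longlongrightarrow> J 0) (at 0)"
    by (simp add: isCont_def)
  have ball: "\<forall>\<^sub>F \<epsilon> in at 0. \<epsilon> \<in> ball 0 r"
    using r(1) by (intro eventually_at_in_open') auto
  \<comment> \<open>For \<alpha> = 0 the matrix A is not perturbed, but then W = \<beta> A is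
    invertible and hence so is A. Otherwise the perturbation is a nonzero multiple of \<epsilon>
    I.\<close>
  have Aeps: "\<forall>\<^sub>F \<epsilon> in at 0. invertible (cmat A + mat (\<alpha> * \<epsilon>))"
  proof (cases "\<alpha> = 0")
    case True
    then have "mat \<alpha> ** cmat E + mat \<beta> ** cmat A = mat \<beta> ** cmat A"
      by (simp add: vec_eq_iff mat_matrix_mult_nth)
    then have "invertible (mat \<beta> ** cmat A)" using assms(2) by metis
    then have "invertible (cmat A)"
      unfolding invertible_iff_kernel by (metis matrix_vector_mul_assoc matrix_vector_mult_0_right)
    then show ?thesis by (simp add: True)
  qed (rule eventually_invertible_add_mat)
  let ?A = "\<lambda>\<epsilon>. cmat A + mat (\<alpha> * \<epsilon>)" and ?E = "\<lambda>\<epsilon>. cmat E - mat (\<beta> * \<epsilon>)"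
  define \<Gamma> where "\<Gamma> \<theta> \<epsilon> = mat (complex_of_real (tan (\<theta> / 2))) ** (?E \<epsilon> + ?A \<epsilon>) - mat \<i> ** (?E \<epsilon> - ?A \<epsilon>)"
    for \<theta> :: real and \<epsilon>
  define \<eta> where "\<eta> = Ln ((complex_of_real (tan (\<theta>2 / 2)) - \<i>) / (complex_of_real (tan (\<theta>1 / 2)) - \<i>))"
  \<comment> \<open>No limit is taken here: at each admissible \<epsilon> both closed forms have the
    exact value \<open>J \<epsilon>\<close>, and the convergence of \<open>J\<close> is transferred
    to them afterwards.\<close>
  have main: "invertible (?A \<epsilon>) \<and> invertible (\<Gamma> \<theta>1 \<epsilon>) \<and> invertible (\<Gamma> \<theta>2 \<epsilon>)
      \<and> mat_log_defined (\<Gamma> \<theta>2 \<epsilon> ** matrix_inv (\<Gamma> \<theta>1 \<epsilon>))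
      \<and> mat_log_defined (matrix_inv (\<Gamma> \<theta>1 \<epsilon>) ** \<Gamma> \<theta>2 \<epsilon>)
      \<and> mat (inverse \<i>) ** matrix_inv (?A \<epsilon>)
          ** (- mat \<eta> + mat_log (\<Gamma> \<theta>2 \<epsilon> ** matrix_inv (\<Gamma> \<theta>1 \<epsilon>))) = J \<epsilon>
      \<and> mat (inverse \<i>) ** (- mat \<eta> + mat_log (matrix_inv (\<Gamma> \<theta>1 \<epsilon>) ** \<Gamma> \<theta>2 \<epsilon>))
          ** matrix_inv (?A \<epsilon>) = J \<epsilon>"
    if \<epsilon>: "\<epsilon> \<in> ball 0 r" and inv: "invertible (?A \<epsilon>)" for \<epsilon>
  proof -
    interpret arc: pencil_arc "?A \<epsilon>" "?E \<epsilon>" \<theta>1 \<theta>2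
      by unfold_locales (use assms(3-7) H[OF \<epsilon>] in \<open>auto simp: H_def\<close>)
    have \<Gamma>: "arc.G arc.t1 = \<Gamma> \<theta>1 \<epsilon>" "arc.G arc.t2 = \<Gamma> \<theta>2 \<epsilon>"
      by (simp_all add: arc.G_def \<Gamma>_def arc.t1_def arc.t2_def)
    have \<eta>: "arc.\<eta> = \<eta>"
      by (simp add: arc.\<eta>_def \<eta>_def arc.t1_def arc.t2_def)
    have J: "integral {\<theta>1..\<theta>2} (\<lambda>\<theta>. matrix_inv (arc.Q \<theta>)) = J \<epsilon>"
      by (simp add: J_def arc.Q_def H_def)
    have "invertible (\<Gamma> \<theta>1 \<epsilon>)" "invertible (\<Gamma> \<theta>2 \<epsilon>)"
      using arc.invertible_G[of arc.t1] arc.invertible_G[of arc.t2] arc.t1_le_t2 by (auto simp: \<Gamma>)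
    then show ?thesis
      using inv arc.mat_log_defined_left arc.mat_log_defined_right
        arc.integral_left[OF inv] arc.integral_right[OF inv]
      unfolding \<Gamma> \<eta> J by blast
  qed
  have ev: "\<forall>\<^sub>F \<epsilon> in at 0. \<epsilon> \<in> ball 0 r \<and> invertible (?A \<epsilon>)"
    using ball Aeps by (rule eventually_conj)
  have I: "integral {\<theta>1..\<theta>2} (\<lambda>\<theta>. matrix_inv (mat (exp (\<i> * of_real \<theta>)) ** cmat E - cmat A)) = J 0"
    by (simp add: J_def H_def)
  show ?thesis
    unfolding Let_def I
  proof (intro conjI, goal_cases)
    case 1
    show ?case
      using ev by (rule eventually_mono) (use main in \<open>simp add: \<Gamma>_def\<close>)
  next
    case 2
    show ?case
      using lim by (rule Lim_transform_eventually, intro eventually_mono[OF ev])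
        (use main in \<open>simp add: \<Gamma>_def \<eta>_def\<close>)
  next
    case 3
    show ?case
      using lim by (rule Lim_transform_eventually, intro eventually_mono[OF ev])
        (use main in \<open>simp add: \<Gamma>_def \<eta>_def\<close>)
  qed
qed

end
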